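(* Let $X=(X_n)_{n\in\mathbb{Z}}$ be a renewal process with $P(X_0=0)>0$, and let $c_k:=P(X_0=0,\,X_k=0)$ for $k\ge 0$. Then $X\in\mathcal{R}$ if and only if $$c_{k-1}c_{k+1}\ge c_k^2\qquad\text{for all } k\ge 1.$$ Moreover, in this case, $X=X^\nu$ (in distribution), where $\nu$ is the translation invariant measure on $\mathcal{P}(\mathbb{Z})\setminus\{\emptyset\}$ given by $$\nu(K)=\begin{cases}\log\dfrac{c_{|K|-1}\,c_{|K|+1}}{c_{|K|}^2} & \text{if } K \text{ is a finite interval},\\[2mm] 0 & \text{otherwise.}\end{cases}$$
   Context: Let $S$ be a finite or countably infinite set, and identify the power set $\mathcal{P}(S)$ with $\{0,1\}^S$ (product topology, Borel $\sigma$-algebra). For a $\sigma$-finite measure $\nu$ on $\mathcal{P}(S)\setminus\{\emptyset\}$, let $Y^\nu=\{B_j\}_{j\in I}$ be the Poisson process on $\mathcal{P}(S)\setminus\{\emptyset\}$ with intensity measure $\nu$. Define $X^\nu=(X^\nu_i)_{i\in S}$ by $X^\nu_i=1$ if $i\in\bigcup_{j\in I}B_j$ and $X^\nu_i=0$ otherwise. $\mathcal{R}$ denotes the set of all $\{0,1\}$-valued processes $(X_i)_{i\in S}$ that are equal in distribution to $X^\nu$ for some $\nu$. Here $S=\mathbb{Z}$; an interval of $\mathbb{Z}$ is a nonempty set of consecutive integers, $|K|$ is the cardinality of $K$, and $\nu(K)$ denotes the mass that $\nu$ gives to the single set $K$ (so $\nu$ is supported on the finite intervals). A non-trivial $\{0,1\}$-valued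 process $X$ on $\mathbb{Z}$ is a renewal process (with respect to $0$) if there is a sequence $(b_n)_{n\ge1}$ of non-negative real numbers with $\sum_{n\ge1}b_n\le 1$ such that, for any $(a_j)_{j\in\mathbb{Z}}\in\{0,1\}^{\mathbb{Z}}$, all $k\in\mathbb{Z}$ and all $n\ge1$, $$P\bigl(\min\{j\ge1: X_{k+j}=0\}=n \,\big|\, X_k=0,\ (X_{k-i})_{i=1}^\infty=(a_{k-i})_{i=1}^\infty\bigr)=b_n.$$ In addition it is always assumed that $\sum_{n=1}^\infty b_n=1$ and that the process is stationary.
   Formalization: Non-trivial is taken to mean that almost surely X takes both values 0 and 1; if X were only required not to be a.s. constant, mixing a renewal process in R with the all-1 process would violate the "moreover" part, as its measure needs an extra atom at the full set of integers. *)

theory Defs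
  imports "HOL-Probability.Probability"
begin

text \<open>Throughout, the finite or countably infinite set \<open>S\<close> is a type of class \<open>countable\<close>.
  As \<open>S\<close> is countable, the Borel sets of \<open>{0,1}\<^sup>S\<close> are the product \<open>\<sigma>\<close>-algebra.\<close>

definition bit_space :: "('a::countable \<Rightarrow> nat) measure" where
  "bit_space = PiM UNIV (\<lambda>_. count_space {0, 1})"

text \<open>The power set of \<open>S\<close>, identified with \<open>{0,1}\<^sup>S\<close> through indicator functions.\<close>

definition powerset_space :: "'a::countable set measure" where
  "powerset_space = vimage_algebra UNIV (\<lambda>B. indicator B) bit_space"

definition nonempty_space :: "'a::countable set measure" where
  "nonempty_space = restrict_space powerset_space (- {{}})"

definition bit_process :: "'w measure \<Rightarrow> ('a::countable \<Rightarrow> 'w \<Rightarrow> nat) \<Rightarrow> bool" where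
  "bit_process M X \<longleftrightarrow> prob_space M \<and> (\<forall>i. X i \<in> M \<rightarrow>\<^sub>M count_space {0, 1})"

definition law :: "'w measure \<Rightarrow> ('a::countable \<Rightarrow> 'w \<Rightarrow> nat) \<Rightarrow> ('a \<Rightarrow> nat) measure" where
  "law M X = distr M bit_space (\<lambda>\<omega> i. X i \<omega>)"


section \<open>Poisson processes and Poisson representable processes\<close>

text \<open>A point configuration is a family of points \<open>B j \<omega>\<close> indexed by the random set
  \<open>j \<in> I \<omega>\<close>; it is a family rather than a set because the intensity measure may have atoms,
  so that points may be repeated.\<close>

definition point_count ::
    "('w \<Rightarrow> nat set) \<Rightarrow> (nat \<Rightarrow> 'w \<Rightarrow> 'e) \<Rightarrow> 'e set \<Rightarrow> 'w \<Rightarrow> ennreal" where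
  "point_count I B A \<omega> = emeasure (count_space UNIV) {j \<in> I \<omega>. B j \<omega> \<in> A}"

definition poisson_process ::
    "'w measure \<Rightarrow> 'e measure \<Rightarrow> ('w \<Rightarrow> nat set) \<Rightarrow> (nat \<Rightarrow> 'w \<Rightarrow> 'e) \<Rightarrow> bool" where
  "poisson_process \<Omega> \<nu> I B \<longleftrightarrow>
     prob_space \<Omega> \<and>
     (\<forall>\<omega>\<in>space \<Omega>. \<forall>j\<in>I \<omega>. B j \<omega> \<in> space \<nu>) \<and>
     (\<forall>A\<in>sets \<nu>. point_count I B A \<in> borel_measurable \<Omega>) \<and>
     (\<forall>A\<in>sets \<nu>. emeasure \<nu> A = \<infinity> \<longrightarrow> (AE \<omega> in \<Omega>. point_count I B A \<omega> = \<infinity>)) \<and>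
     (\<forall>A\<in>sets \<nu>. emeasure \<nu> A < \<infinity> \<longrightarrow>
        (\<forall>n::nat. measure \<Omega> {\<omega> \<in> space \<Omega>. point_count I B A \<omega> = of_nat n} =
           measure \<nu> A ^ n / fact n * exp (- measure \<nu> A))) \<and>
     (\<forall>(m::nat) A. A ` {..<m} \<subseteq> sets \<nu> \<and> disjoint_family_on A {..<m} \<longrightarrow>
        prob_space.indep_vars \<Omega> (\<lambda>_. borel) (\<lambda>l. point_count I B (A l)) {..<m})"

definition union_process ::
    "('w \<Rightarrow> nat set) \<Rightarrow> (nat \<Rightarrow> 'w \<Rightarrow> 'a set) \<Rightarrow> 'a \<Rightarrow> 'w \<Rightarrow> nat" where
  "union_process I B i \<omega> = indicator (\<Union>j\<in>I \<omega>. B j \<omega>) i"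

definition intensity_measure :: "'a::countable set measure \<Rightarrow> bool" where
  "intensity_measure \<nu> \<longleftrightarrow> sets \<nu> = sets nonempty_space \<and> sigma_finite_measure \<nu>"

text \<open>\<open>X\<close> is equal in distribution to \<open>X\<^sup>\<nu>\<close>. The law of \<open>X\<^sup>\<nu>\<close> depends only on \<open>\<nu>\<close>, not on the
  Poisson process used. HOL cannot quantify over the type of the sample space, so the canonical
  one is used: pairs of an index set and a family of points. Any Poisson process in the above
  sense can be transported to it along \<open>\<omega> \<mapsto> (I \<omega>, \<lambda>j. B j \<omega>)\<close>.\<close>

definition represented_by ::
    "'w measure \<Rightarrow> ('a::countable \<Rightarrow> 'w \<Rightarrow> nat) \<Rightarrow> 'a set measure \<Rightarrow> bool" where
  "represented_by M X \<nu> \<longleftrightarrow>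
     intensity_measure \<nu> \<and>
     (\<exists>(\<Omega> :: (nat set \<times> (nat \<Rightarrow> 'a set)) measure) I B.
        poisson_process \<Omega> \<nu> I B \<and> law M X = law \<Omega> (union_process I B))"

text \<open>Membership of the process \<open>X\<close> in the class \<open>\<R>\<close>.\<close>

definition poisson_representable ::
    "'w measure \<Rightarrow> ('a::countable \<Rightarrow> 'w \<Rightarrow> nat) \<Rightarrow> bool" where
  "poisson_representable M X \<longleftrightarrow> bit_process M X \<and> (\<exists>\<nu>. represented_by M X \<nu>)"


section \<open>Stationary renewal processes\<close>

definition stationary :: "'w measure \<Rightarrow> (int \<Rightarrow> 'w \<Rightarrow> nat) \<Rightarrow> bool" where
  "stationary M X \<longleftrightarrow> (\<forall>k. law M (\<lambda>i. X (i + k)) = law M X)"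

text \<open>Non-triviality is meant pathwise: almost no realisation is constant. It is not enough to
  ask that \<open>X\<close> is not almost surely constant: the mixture of a renewal process with the process
  that is identically 1 has the same conditional probabilities given \<open>X\<^sub>k = 0\<close>, and its
  representing measure has an additional atom at the full set.\<close>

definition nontrivial :: "'w measure \<Rightarrow> (int \<Rightarrow> 'w \<Rightarrow> nat) \<Rightarrow> bool" where
  "nontrivial M X \<longleftrightarrow> (AE \<omega> in M. (\<exists>i. X i \<omega> = 0) \<and> (\<exists>i. X i \<omega> = 1))"

text \<open>The \<open>\<sigma>\<close>-algebra generated by \<open>X\<^sub>k, X\<^sub>k\<^sub>-\<^sub>1, X\<^sub>k\<^sub>-\<^sub>2, \<dots>\<close>\<close>

definition past_algebra :: "'w measure \<Rightarrow> (int \<Rightarrow> 'w \<Rightarrow> nat) \<Rightarrow> int \<Rightarrow> 'w measure" where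
  "past_algebra M X k =
     vimage_algebra (space M) (\<lambda>\<omega> (i::nat). X (k - int i) \<omega>) bit_space"

text \<open>The event \<open>min {j \<ge> 1. X\<^sub>k\<^sub>+\<^sub>j = 0} = n\<close>, for \<open>n \<ge> 1\<close>\<close>

definition next_zero_event ::
    "'w measure \<Rightarrow> (int \<Rightarrow> 'w \<Rightarrow> nat) \<Rightarrow> int \<Rightarrow> nat \<Rightarrow> 'w set" where
  "next_zero_event M X k n =
     {\<omega> \<in> space M. X (k + int n) \<omega> = 0 \<and> (\<forall>j\<in>{1..<n}. X (k + int j) \<omega> \<noteq> 0)}"

text \<open>A single past has probability zero in general, so the conditional probabilities given
  \<open>X\<^sub>k = 0\<close> and the past are read as conditional expectations, almost surely on \<open>X\<^sub>k = 0\<close>.\<close>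

definition renewal_process :: "'w measure \<Rightarrow> (int \<Rightarrow> 'w \<Rightarrow> nat) \<Rightarrow> bool" where
  "renewal_process M X \<longleftrightarrow>
     bit_process M X \<and> nontrivial M X \<and> stationary M X \<and>
     (\<exists>b :: nat \<Rightarrow> real.
        (\<forall>n\<ge>1. 0 \<le> b n) \<and> (\<lambda>n. b (Suc n)) sums 1 \<and>
        (\<forall>k. \<forall>n\<ge>1. AE \<omega> in M. X k \<omega> = 0 \<longrightarrow>
           real_cond_exp M (past_algebra M X k) (indicator (next_zero_event M X k n)) \<omega> = b n))"

definition zero_corr :: "'w measure \<Rightarrow> (int \<Rightarrow> 'w \<Rightarrow> nat) \<Rightarrow> nat \<Rightarrow> real" where
  "zero_corr M X k = measure M {\<omega> \<in> space M. X 0 \<omega> = 0 \<and> X (int k) \<omega> = 0}"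


section \<open>The measure on finite intervals\<close>

definition finite_intervals :: "int set set" where
  "finite_intervals = {K. \<exists>a b. a \<le> b \<and> K = {a..b}}"

definition translation_invariant :: "int set measure \<Rightarrow> bool" where
  "translation_invariant \<nu> \<longleftrightarrow> (\<forall>k. distr \<nu> \<nu> (\<lambda>B. (+) k ` B) = \<nu>)"

text \<open>The purely atomic measure with the given masses of single sets. A point measure lives on
  the \<open>\<sigma>\<close>-algebra of all subsets; the outer \<open>distr\<close> restricts it to the Borel sets.\<close>

definition renewal_intensity :: "(nat \<Rightarrow> real) \<Rightarrow> int set measure" where
  "renewal_intensity c =
     distr
       (point_measure (- {{}})
         (\<lambda>K. ennreal (if K \<in> finite_intervals
            then ln (c (card K - 1) * c (card K + 1) / (c (card K))\<^sup>2) else 0)))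
       nonempty_space (\<lambda>K. K)"

end

theory Submission
  imports Defs
begin

text \<open>Write \<open>\<ell> k = ln (c k)\<close>. By the renewal property, the probability that \<open>X\<close> vanishes at
  \<open>a\<^sub>1 \<le> \<dots> \<le> a\<^sub>m\<close> is \<open>c 0\<close> times the product of the \<open>c (a\<^sub>i\<^sub>+\<^sub>1 - a\<^sub>i) / c 0\<close>, whereas for \<open>X\<^sup>\<nu>\<close> it is
  \<open>exp (- \<nu> {B. B meets {a\<^sub>1, \<dots>, a\<^sub>m}})\<close>.

  If \<open>X\<close> is representable, the \<open>\<nu>\<close>-measure of the sets that contain \<open>1\<close> and \<open>k\<close> but neither \<open>0\<close> nor
  \<open>k + 1\<close> is nonnegative; by inclusion-exclusion this measure is \<open>\<ell> (k + 1) + \<ell> (k - 1) - 2 * \<ell> k\<close>.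

  Conversely, log-convexity makes \<open>c\<close> decreasing, and the renewal equation identifies its limit as
  \<open>(c 0)\<^sup>2\<close>. Telescoping the second differences of \<open>\<ell>\<close> then shows that the proposed \<open>\<nu>\<close> gives mass
  \<open>- \<ell> 0\<close> to the intervals containing \<open>e\<close> and mass \<open>\<ell> 0 - \<ell> (e - k)\<close> to those which in addition
  avoid \<open>k < e\<close>. An interval that contains \<open>e\<close> and avoids the largest element \<open>k < e\<close> of a set \<open>A\<close>
  avoids all of \<open>A\<close>, so induction on \<open>A\<close> matches the two formulas above.\<close>

section \<open>Laws of bit processes and avoidance probabilities\<close>

lemma space_bit_space: "space (bit_space :: ('a::countable \<Rightarrow> nat) measure) = {f. \<forall>i. f i \<in> {0, 1}}"
  by (auto simp: bit_space_def space_PiM PiE_def Pi_def)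

lemma measurable_bit_spaceI:
  fixes X :: "'a::countable \<Rightarrow> 'w \<Rightarrow> nat"
  assumes "\<And>i. X i \<in> M \<rightarrow>\<^sub>M count_space {0, 1}"
  shows "(\<lambda>\<omega> i. X i \<omega>) \<in> M \<rightarrow>\<^sub>M bit_space"
  unfolding bit_space_def
proof (rule measurable_PiM_single')
  show "(\<lambda>\<omega> i. X i \<omega>) \<in> space M \<rightarrow> (\<Pi>\<^sub>E i\<in>UNIV. space (count_space {0, 1}))"
    using measurable_space[OF assms] by (auto simp: PiE_def Pi_def)
qed (use assms in auto)

lemma measurable_bit_space_component:
  "(\<lambda>f. f i) \<in> (bit_space :: ('a::countable \<Rightarrow> nat) measure) \<rightarrow>\<^sub>M count_space {0, 1}"
  unfolding bit_space_def by (rule measurable_component_singleton) simp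

definition zeros :: "'w measure \<Rightarrow> ('a \<Rightarrow> 'w \<Rightarrow> nat) \<Rightarrow> 'a set \<Rightarrow> 'w set" where
  "zeros M X A = {\<omega> \<in> space M. \<forall>i\<in>A. X i \<omega> = 0}"

lemma zero_event_sets:
  assumes "X \<in> M \<rightarrow>\<^sub>M count_space {0, 1::nat}"
  shows "{\<omega> \<in> space M. X \<omega> = 0} \<in> sets M"
proof -
  have "X -` {0} \<inter> space M \<in> sets M" by (rule measurable_sets[OF assms]) auto
  also have "X -` {0} \<inter> space M = {\<omega> \<in> space M. X \<omega> = 0}" by auto
  finally show ?thesis .
qed

lemma zeros_sets:
  assumes "\<And>i. i \<in> A \<Longrightarrow> X i \<in> M \<rightarrow>\<^sub>M count_space {0, 1}" "countable A"
  shows "zeros M X A \<in> sets M"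
proof -
  \<comment> \<open>The complement of a union stays inside \<open>space M\<close> even for
    \<open>A = {}\<close>, where an intersection over \<open>A\<close> would not.\<close>
  have "zeros M X A = space M - (\<Union>i\<in>A. space M - {\<omega> \<in> space M. X i \<omega> = 0})"
    by (auto simp: zeros_def)
  also have "\<dots> \<in> sets M"
    by (intro sets.Diff sets.countable_UN'' sets.top zero_event_sets assms)
  finally show ?thesis .
qed

text \<open>This generator is chosen because it is closed under intersection: a law on the bit space
  is then determined by the probabilities that finitely many coordinates all vanish. It suffices as
  generator since, with only two values, \<open>f i = 1\<close> is the complement of
  \<open>f i = 0\<close>.\<close>

lemma sets_bit_space:
  "sets (bit_space :: ('a::countable \<Rightarrow> nat) measure) =
     sigma_sets {f. \<forall>i. f i \<in> {0, 1}}
       {{f. (\<forall>i. f i \<in> {0, 1}) \<and> (\<forall>i\<in>A. f i = 0)} | A. finite A}"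
    (is "_ = sigma_sets ?S ?G")
proof
  let ?B = "bit_space :: ('a \<Rightarrow> nat) measure"
  have "?G \<subseteq> sets ?B"
  proof safe
    fix A :: "'a set" assume "finite A"
    then have "zeros ?B (\<lambda>i f. f i) A \<in> sets ?B"
      by (intro zeros_sets measurable_bit_space_component countable_finite)
    then show "{f. (\<forall>i. f i \<in> {0, 1}) \<and> (\<forall>i\<in>A. f i = 0)} \<in> sets ?B"
      by (simp add: zeros_def space_bit_space)
  qed
  then show "sigma_sets ?S ?G \<subseteq> sets ?B"
    using sets.sigma_sets_subset[of ?G ?B] by (simp add: space_bit_space)
  interpret sigma_algebra ?S "sigma_sets ?S ?G"
    by (rule sigma_algebra_sigma_sets) auto
  have zero: "{f \<in> ?S. f i = 0} \<in> sigma_sets ?S ?G" for i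
  proof -
    have "{f. (\<forall>i. f i \<in> {0, 1}) \<and> (\<forall>i\<in>{i}. f i = 0)} \<in> ?G"
      by blast
    then show ?thesis by (intro sigma_sets.Basic) simp
  qed
  have "{f \<in> ?S. f i \<in> A} \<in> sigma_sets ?S ?G" if "A \<subseteq> {0, 1::nat}" for i A
  proof -
    have "A \<in> Pow {0, 1}" using that by simp
    then consider "A = {}" | "A = {0}" | "A = {1}" | "A = {0, 1}"
      by (auto simp: Pow_insert)
    then show ?thesis
    proof cases
      case 1
      then show ?thesis by (simp add: sigma_sets.Empty)
    next
      case 3
      then have "{f \<in> ?S. f i \<in> A} = ?S - {f \<in> ?S. f i = 0}"
        by (auto dest: spec[of _ i])
      then show ?thesis by (simp only: Diff top zero)
    next
      case 4
      then have "{f \<in> ?S. f i \<in> A} = ?S" by auto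
      then show ?thesis by (simp only: top)
    qed (use zero[of i] in simp_all)
  qed
  then show "sets ?B \<subseteq> sigma_sets ?S ?G"
    unfolding bit_space_def sets_PiM_single
    by (intro sigma_sets_subset') (auto simp: PiE_def Pi_def)
qed

lemma measure_law_zeros:
  fixes X :: "'a::countable \<Rightarrow> 'w \<Rightarrow> nat"
  assumes "bit_process M X"
  shows "measure (law M X) (zeros bit_space (\<lambda>i f. f i) A) = measure M (zeros M X A)"
proof -
  have X: "(\<lambda>\<omega> i. X i \<omega>) \<in> M \<rightarrow>\<^sub>M bit_space"
    using assms by (intro measurable_bit_spaceI) (auto simp: bit_process_def)
  have "(\<lambda>\<omega> i. X i \<omega>) -` zeros bit_space (\<lambda>i f. f i) A \<inter> space M = zeros M X A"
    using measurable_space[OF X] by (auto simp: zeros_def)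
  moreover have "zeros bit_space (\<lambda>i f. f i) A \<in> sets (bit_space :: ('a \<Rightarrow> nat) measure)"
    by (intro zeros_sets measurable_bit_space_component) auto
  ultimately show ?thesis
    unfolding law_def by (simp add: measure_distr[OF X])
qed

text \<open>Dynkin's argument: \<open>?C A \<inter> ?C B = ?C (A \<union> B)\<close>, so the zero
  events form an intersection-stable generator that contains the whole space.\<close>

lemma law_eqI:
  fixes X :: "'a::countable \<Rightarrow> 'w \<Rightarrow> nat" and Y :: "'a \<Rightarrow> 'v \<Rightarrow> nat"
  assumes X: "bit_process M X" and Y: "bit_process N Y"
    and eq: "\<And>A. finite A \<Longrightarrow> measure M (zeros M X A) = measure N (zeros N Y A)"
  shows "law M X = law N Y"
proof (rule measure_eqI_generator_eq)
  let ?S = "{f :: 'a \<Rightarrow> nat. \<forall>i. f i \<in> {0, 1}}"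
  let ?C = "\<lambda>A. {f :: 'a \<Rightarrow> nat. (\<forall>i. f i \<in> {0, 1}) \<and> (\<forall>i\<in>A. f i = 0)}"
  let ?G = "{?C A | A. finite A}"
  have Xm: "(\<lambda>\<omega> i. X i \<omega>) \<in> M \<rightarrow>\<^sub>M bit_space" and Ym: "(\<lambda>\<omega> i. Y i \<omega>) \<in> N \<rightarrow>\<^sub>M bit_space"
    using X Y by (auto simp: bit_process_def intro!: measurable_bit_spaceI)
  interpret LX: prob_space "law M X"
    unfolding law_def using X by (intro prob_space.prob_space_distr Xm) (auto simp: bit_process_def)
  interpret LY: prob_space "law N Y"
    unfolding law_def using Y by (intro prob_space.prob_space_distr Ym) (auto simp: bit_process_def)
  show "Int_stable ?G"
  proof (rule Int_stableI)
    fix a b assume "a \<in> ?G" "b \<in> ?G"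
    then obtain A B where AB: "a = ?C A" "b = ?C B" "finite A" "finite B" by auto
    then have "a \<inter> b = ?C (A \<union> B)" by auto
    with AB(3,4) show "a \<inter> b \<in> ?G" by blast
  qed
  show "emeasure (law M X) S = emeasure (law N Y) S" if "S \<in> ?G" for S
  proof -
    from that obtain A where A: "S = zeros bit_space (\<lambda>i f. f i) A" "finite A"
      by (auto simp: zeros_def space_bit_space)
    then have "measure (law M X) S = measure (law N Y) S"
      by (simp add: measure_law_zeros X Y eq)
    then show ?thesis
      by (simp add: LX.emeasure_eq_measure LY.emeasure_eq_measure)
  qed
  show "sets (law M X) = sigma_sets ?S ?G" "sets (law N Y) = sigma_sets ?S ?G"
    by (auto simp: law_def sets_bit_space)
  show "range (\<lambda>_::nat. ?S) \<subseteq> ?G"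
    by (auto intro!: exI[of _ "{}"])
  show "emeasure (law M X) ?S \<noteq> \<infinity>" by simp
qed auto

section \<open>Void probabilities of a Poisson process\<close>

definition hitting :: "'a set \<Rightarrow> 'a set set" where
  "hitting A = {B. B \<inter> A \<noteq> {}}"

lemma space_nonempty_space: "space (nonempty_space :: 'a::countable set measure) = - {{}}"
  by (auto simp: nonempty_space_def powerset_space_def space_restrict_space)

lemma sets_powerset_space_contain: "{B. i \<in> B} \<in> sets (powerset_space :: 'a::countable set measure)"
proof -
  have "(\<lambda>B i. indicator B i :: nat) \<in> powerset_space \<rightarrow>\<^sub>M (bit_space :: ('a \<Rightarrow> nat) measure)"
    unfolding powerset_space_def
    by (rule measurable_vimage_algebra1) (auto simp: space_bit_space indicator_def)
  from measurable_compose[OF this measurable_bit_space_component]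
  have "(\<lambda>B. indicator B i :: nat) \<in> (powerset_space :: 'a set measure) \<rightarrow>\<^sub>M count_space {0, 1}" .
  then have "(\<lambda>B. indicator B i :: nat) -` {1} \<inter> space powerset_space \<in> sets (powerset_space :: 'a set measure)"
    by (rule measurable_sets) auto
  also have "(\<lambda>B. indicator B i :: nat) -` {1} \<inter> space powerset_space = {B. i \<in> B}"
    by (auto simp: powerset_space_def indicator_def of_bool_def split: if_splits)
  finally show ?thesis .
qed

lemma sets_nonempty_space_contain: "{B. i \<in> B} \<in> sets (nonempty_space :: 'a::countable set measure)"
proof -
  have "{B. i \<in> B} = - {{}} \<inter> {B. i \<in> B}" by auto
  also have "\<dots> \<in> sets (nonempty_space :: 'a set measure)"
    unfolding nonempty_space_def sets_restrict_space by (intro imageI sets_powerset_space_contain)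
  finally show ?thesis .
qed

lemma hitting_eq_UN: "hitting A = (\<Union>i\<in>A. {B. i \<in> B})"
  by (auto simp: hitting_def)

lemma sets_nonempty_space_hitting: "hitting A \<in> sets (nonempty_space :: 'a::countable set measure)"
  unfolding hitting_eq_UN by (intro sets.countable_UN'' sets_nonempty_space_contain) auto

lemma point_count_eq_0_iff: "point_count I B A \<omega> = 0 \<longleftrightarrow> (\<forall>j\<in>I \<omega>. B j \<omega> \<notin> A)"
  by (auto simp: point_count_def emeasure_count_space_eq_0)

lemma union_process_zero_iff:
  "(\<forall>i\<in>A. union_process I B i \<omega> = 0) \<longleftrightarrow> point_count I B (hitting A) \<omega> = 0"
  by (auto simp: union_process_def point_count_eq_0_iff hitting_def indicator_def disjoint_iff)

lemma poisson_process_union_process: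
  assumes P: "poisson_process \<Omega> \<nu> I B" and sets: "sets \<nu> = sets (nonempty_space :: 'a::countable set measure)"
  shows "bit_process \<Omega> (union_process I B)"
  unfolding bit_process_def
proof (intro conjI allI)
  show "prob_space \<Omega>" using P by (simp add: poisson_process_def)
  fix i :: 'a
  have pc: "point_count I B (hitting {i}) \<in> borel_measurable \<Omega>"
    using P sets_nonempty_space_hitting[of "{i}"] by (auto simp: poisson_process_def sets)
  \<comment> \<open>\<open>poisson_process\<close> provides measurability of counts, so the
    coordinate is expressed through the number of points that contain \<open>i\<close>.\<close>
  have eq: "union_process I B i = (\<lambda>\<omega>. if point_count I B (hitting {i}) \<omega> = 0 then 0 else 1)"
  proof
    fix \<omega> show "union_process I B i \<omega> = (if point_count I B (hitting {i}) \<omega> = 0 then 0 else 1)"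
      using union_process_zero_iff[of "{i}" I B \<omega>] by (auto simp: union_process_def indicator_def)
  qed
  show "union_process I B i \<in> \<Omega> \<rightarrow>\<^sub>M count_space {0, 1}"
    unfolding eq using pc by measurable
qed

text \<open>The union avoids \<open>A\<close> exactly when no point hits \<open>A\<close>, which is
  the case \<open>n = 0\<close> of the Poisson distribution. The infinite case is separate because
  \<open>measure\<close> is 0 there, so that the exponential would wrongly be 1.\<close>

lemma poisson_process_zeros:
  assumes P: "poisson_process \<Omega> \<nu> I B" and sets: "sets \<nu> = sets (nonempty_space :: 'a::countable set measure)"
  shows "measure \<Omega> (zeros \<Omega> (union_process I B) A) =
    (if emeasure \<nu> (hitting A) = \<infinity> then 0 else exp (- measure \<nu> (hitting A)))"
proof -
  interpret prob_space \<Omega> using P by (simp add: poisson_process_def)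
  have h: "hitting A \<in> sets \<nu>" by (simp add: sets sets_nonempty_space_hitting)
  have z: "zeros \<Omega> (union_process I B) A = {\<omega> \<in> space \<Omega>. point_count I B (hitting A) \<omega> = of_nat 0}"
    unfolding zeros_def union_process_zero_iff by simp
  show ?thesis
  proof (cases "emeasure \<nu> (hitting A) = \<infinity>")
    case True
    then have "AE \<omega> in \<Omega>. point_count I B (hitting A) \<omega> = \<infinity>"
      using P h by (auto simp: poisson_process_def)
    then have "AE \<omega> in \<Omega>. point_count I B (hitting A) \<omega> \<noteq> of_nat 0" by eventually_elim simp
    then show ?thesis
      unfolding z using True by (simp add: prob_eq_0_AE)
  next
    case False
    then have "emeasure \<nu> (hitting A) < \<infinity>" by (simp add: top.not_eq_extremum)
    with P h have "measure \<Omega> {\<omega> \<in> space \<Omega>. point_count I B (hitting A) \<omega> = of_nat 0} =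
        measure \<nu> (hitting A) ^ 0 / fact 0 * exp (- measure \<nu> (hitting A))"
      unfolding poisson_process_def by blast
    with False show ?thesis unfolding z by simp
  qed
qed

section \<open>Poisson processes with purely atomic intensity\<close>

text \<open>The binomial theorem divided by \<open>fact n\<close>; it makes the sum of two
  independent Poisson variables Poisson.\<close>

lemma poisson_mass_convolution:
  fixes r s :: real
  shows "(\<Sum>i\<le>n. (r ^ i / fact i * exp (- r)) * (s ^ (n - i) / fact (n - i) * exp (- s))) =
    (r + s) ^ n / fact n * exp (- (r + s))"
proof -
  have "(r + s) ^ n / fact n = (\<Sum>i\<le>n. (r ^ i / fact i) * (s ^ (n - i) / fact (n - i)))"
    unfolding binomial_ring sum_divide_distrib
    by (intro sum.cong refl) (simp add: binomial_fact)
  moreover have "exp (- (r + s)) = exp (- r) * exp (- s)"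
    by (simp flip: exp_add)
  ultimately show ?thesis
    by (simp add: sum_distrib_left ac_simps)
qed

locale poisson_family = prob_space +
  fixes N :: "nat \<Rightarrow> 'a \<Rightarrow> nat" and r :: "nat \<Rightarrow> real"
  assumes indep: "indep_vars (\<lambda>_. count_space UNIV) N UNIV"
    and rate_nonneg: "0 \<le> r m"
    and prob_N: "prob {\<omega> \<in> space M. N m \<omega> = n} = r m ^ n / fact n * exp (- r m)"
begin

lemma measurable_N [measurable]: "N m \<in> M \<rightarrow>\<^sub>M count_space UNIV"
  using indep by (simp add: indep_vars_def)

definition total :: "nat set \<Rightarrow> 'a \<Rightarrow> ennreal" where
  "total A \<omega> = (\<Sum>m. if m \<in> A then of_nat (N m \<omega>) else 0)"

lemma measurable_total [measurable]: "total A \<in> borel_measurable M"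
  unfolding total_def by measurable

text \<open>Each \<open>total (A l)\<close> is a function of the block of variables indexed by
  \<open>A l\<close>, and disjoint blocks of an independent family are independent.\<close>

lemma indep_vars_total:
  assumes "disjoint_family_on A L"
  shows "indep_vars (\<lambda>_. borel) (\<lambda>l. total (A l)) L"
proof -
  let ?Y = "\<lambda>l f. \<Sum>m. if m \<in> A l then of_nat (f m) else 0 :: ennreal"
  have "indep_vars (\<lambda>j. PiM (A j) (\<lambda>_. count_space UNIV)) (\<lambda>j \<omega>. restrict (\<lambda>i. N i \<omega>) (A j)) L"
    using assms by (intro indep_vars_restrict[OF indep]) auto
  then have "indep_vars (\<lambda>_. borel) (\<lambda>l. ?Y l \<circ> (\<lambda>\<omega>. restrict (\<lambda>i. N i \<omega>) (A l))) L"
  proof (rule indep_vars_compose)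
    fix l
    have "(\<lambda>f. if m \<in> A l then of_nat (f m) else 0 :: ennreal)
        \<in> borel_measurable (PiM (A l) (\<lambda>_. count_space UNIV))" for m
    proof (cases "m \<in> A l")
      case True
      then have "(\<lambda>f. f m) \<in> PiM (A l) (\<lambda>_. count_space UNIV) \<rightarrow>\<^sub>M count_space UNIV"
        by (rule measurable_component_singleton)
      with True show ?thesis by simp
    qed simp
    then show "?Y l \<in> borel_measurable (PiM (A l) (\<lambda>_. count_space UNIV))"
      by (rule borel_measurable_suminf_order)
  qed
  moreover have "?Y l \<circ> (\<lambda>\<omega>. restrict (\<lambda>i. N i \<omega>) (A l)) = total (A l)" for l
    by (auto simp: fun_eq_iff total_def intro!: suminf_cong)
  ultimately show ?thesis by simp
qed

lemma total_finite: "finite F \<Longrightarrow> total F \<omega> = of_nat (\<Sum>m\<in>F. N m \<omega>)"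
  unfolding total_def by (subst suminf_finite[of F]) auto

lemma prob_finite_sum:
  assumes "finite F"
  shows "prob {\<omega> \<in> space M. (\<Sum>m\<in>F. N m \<omega>) = n} = sum r F ^ n / fact n * exp (- sum r F)"
  using assms
proof (induction F arbitrary: n)
  case empty
  show ?case by (cases "n = 0") (auto simp: prob_space)
next
  case (insert a F)
  \<comment> \<open>Indexing the two blocks \<open>{a}\<close> and \<open>F\<close> by the booleans
    turns the independence of \<open>N a\<close> and the sum over \<open>F\<close> into an instance
    of \<open>indep_vars_total\<close>.\<close>
  let ?A = "\<lambda>l. if l then {a} else F"
  have "indep_vars (\<lambda>_. borel) (\<lambda>l. total (?A l)) (UNIV :: bool set)"
    using insert by (intro indep_vars_total) (auto simp: disjoint_family_on_def)
  have prod: "prob {\<omega> \<in> space M. N a \<omega> = i \<and> (\<Sum>m\<in>F. N m \<omega>) = j} =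
      prob {\<omega> \<in> space M. N a \<omega> = i} * prob {\<omega> \<in> space M. (\<Sum>m\<in>F. N m \<omega>) = j}" for i j
  proof -
    let ?S = "\<lambda>l. {of_nat (if l then i else j)} :: ennreal set"
    have "prob (\<Inter>l\<in>UNIV. total (?A l) -` ?S l \<inter> space M) =
        (\<Prod>l\<in>UNIV. prob (total (?A l) -` ?S l \<inter> space M))"
      by (rule indep_varsD_finite) (fact, auto)
    also have "(\<Inter>l\<in>UNIV. total (?A l) -` ?S l \<inter> space M) =
        {\<omega> \<in> space M. N a \<omega> = i \<and> (\<Sum>m\<in>F. N m \<omega>) = j}"
      using insert by (auto simp: UNIV_bool total_finite simp del: of_nat_sum)
    also have "(\<Prod>l\<in>UNIV. prob (total (?A l) -` ?S l \<inter> space M)) =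
        prob (total {a} -` {of_nat i} \<inter> space M) * prob (total F -` {of_nat j} \<inter> space M)"
      by (simp add: UNIV_bool mult.commute)
    also have "total {a} -` {of_nat i} \<inter> space M = {\<omega> \<in> space M. N a \<omega> = i}"
      by (auto simp: total_finite)
    also have "total F -` {of_nat j} \<inter> space M = {\<omega> \<in> space M. (\<Sum>m\<in>F. N m \<omega>) = j}"
      using insert by (auto simp: total_finite simp del: of_nat_sum)
    finally show ?thesis .
  qed
  have "{\<omega> \<in> space M. (\<Sum>m\<in>insert a F. N m \<omega>) = n} =
      (\<Union>i\<le>n. {\<omega> \<in> space M. N a \<omega> = i \<and> (\<Sum>m\<in>F. N m \<omega>) = n - i})"
    using insert by auto
  also have "prob \<dots> = (\<Sum>i\<le>n. prob {\<omega> \<in> space M. N a \<omega> = i \<and> (\<Sum>m\<in>F. N m \<omega>) = n - i})"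
    by (intro finite_measure_finite_Union) (auto simp: disjoint_family_on_def)
  also have "\<dots> = (\<Sum>i\<le>n. (r a ^ i / fact i * exp (- r a)) *
      (sum r F ^ (n - i) / fact (n - i) * exp (- sum r F)))"
    by (simp only: prod prob_N insert.IH)
  also have "\<dots> = (r a + sum r F) ^ n / fact n * exp (- (r a + sum r F))"
    by (rule poisson_mass_convolution)
  finally show ?case using insert by simp
qed

lemma prob_finite_sum_le:
  assumes "finite F"
  shows "prob {\<omega> \<in> space M. (\<Sum>m\<in>F. N m \<omega>) \<le> n} = (\<Sum>k\<le>n. sum r F ^ k / fact k * exp (- sum r F))"
proof -
  have "{\<omega> \<in> space M. (\<Sum>m\<in>F. N m \<omega>) \<le> n} = (\<Union>k\<le>n. {\<omega> \<in> space M. (\<Sum>m\<in>F. N m \<omega>) = k})"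
    by auto
  also have "prob \<dots> = (\<Sum>k\<le>n. prob {\<omega> \<in> space M. (\<Sum>m\<in>F. N m \<omega>) = k})"
    by (intro finite_measure_finite_Union) (auto simp: disjoint_family_on_def)
  finally show ?thesis by (simp add: prob_finite_sum assms)
qed

lemma total_le_iff: "total A \<omega> \<le> of_nat n \<longleftrightarrow> (\<forall>k. (\<Sum>m\<in>A \<inter> {..<k}. N m \<omega>) \<le> n)"
proof -
  have "(\<Sum>m<k. if m \<in> A then of_nat (N m \<omega>) else 0) = (of_nat (\<Sum>m\<in>A \<inter> {..<k}. N m \<omega>) :: ennreal)" for k
    by (simp add: sum.If_cases Int_def conj_commute)
  then show ?thesis
    by (simp add: total_def suminf_eq_SUP SUP_le_iff del: of_nat_sum)
qed

text \<open>The event for \<open>total A\<close> is the decreasing intersection of those for the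
  finite truncations. No convergence of the rates is assumed, so the limit serves both finite and
  infinite total rate.\<close>

lemma prob_total_le_limit:
  "(\<lambda>k. \<Sum>i\<le>n. sum r (A \<inter> {..<k}) ^ i / fact i * exp (- sum r (A \<inter> {..<k})))
     \<longlonglongrightarrow> prob {\<omega> \<in> space M. total A \<omega> \<le> of_nat n}"
proof -
  let ?E = "\<lambda>k. {\<omega> \<in> space M. (\<Sum>m\<in>A \<inter> {..<k}. N m \<omega>) \<le> n}"
  have "(\<lambda>k. prob (?E k)) \<longlonglongrightarrow> prob (\<Inter>k. ?E k)"
  proof (rule finite_Lim_measure_decseq)
    show "range ?E \<subseteq> events" by auto
    show "decseq ?E"
    proof (rule decseq_SucI, safe)
      fix k \<omega> assume "(\<Sum>m\<in>A \<inter> {..<Suc k}. N m \<omega>) \<le> n"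
      moreover have "(\<Sum>m\<in>A \<inter> {..<k}. N m \<omega>) \<le> (\<Sum>m\<in>A \<inter> {..<Suc k}. N m \<omega>)"
        by (rule sum_mono2) auto
      ultimately show "(\<Sum>m\<in>A \<inter> {..<k}. N m \<omega>) \<le> n" by simp
    qed
  qed
  moreover have "(\<Inter>k. ?E k) = {\<omega> \<in> space M. total A \<omega> \<le> of_nat n}"
    unfolding total_le_iff by auto
  ultimately show ?thesis by (simp add: prob_finite_sum_le)
qed

text \<open>A supremum of integers takes no value strictly between \<open>n\<close> and
  \<open>n + 1\<close>: once it exceeds \<open>n\<close>, some partial sum is at least
  \<open>n + 1\<close>.\<close>

lemma total_le_Suc_iff:
  "total A \<omega> \<le> of_nat (Suc n) \<longleftrightarrow> total A \<omega> \<le> of_nat n \<or> total A \<omega> = of_nat (Suc n)"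
proof -
  have "total A \<omega> = of_nat (Suc n)" if "total A \<omega> \<le> of_nat (Suc n)" "\<not> total A \<omega> \<le> of_nat n"
  proof (rule antisym)
    from that(2) obtain k where "\<not> (\<Sum>m\<in>A \<inter> {..<k}. N m \<omega>) \<le> n"
      by (auto simp: total_le_iff)
    then have "(of_nat (Suc n) :: ennreal) \<le> of_nat (\<Sum>m\<in>A \<inter> {..<k}. N m \<omega>)"
      unfolding of_nat_le_iff by simp
    also have "\<dots> = (\<Sum>m<k. if m \<in> A then of_nat (N m \<omega>) else 0)"
      by (simp add: sum.If_cases Int_def conj_commute)
    also have "\<dots> \<le> total A \<omega>"
      unfolding total_def by (rule sum_le_suminf) auto
    finally show "of_nat (Suc n) \<le> total A \<omega>" .
  qed fact
  moreover have "total A \<omega> \<le> of_nat (Suc n)" if "total A \<omega> \<le> of_nat n"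
    using that by (rule order_trans) (simp add: of_nat_le_iff del: of_nat_Suc)
  ultimately show ?thesis by auto
qed

lemma sum_rate_Int: "(\<Sum>m<k. if m \<in> A then r m else 0) = sum r (A \<inter> {..<k})"
  by (simp add: sum.If_cases Int_def conj_commute)

text \<open>The distribution function depends continuously on the rate, so it passes to the limit of
  the truncations; point masses are its successive differences.\<close>

lemma prob_total_eq:
  assumes "(\<lambda>m. if m \<in> A then r m else 0) sums R"
  shows "prob {\<omega> \<in> space M. total A \<omega> = of_nat n} = R ^ n / fact n * exp (- R)"
proof -
  have lim: "(\<lambda>k. sum r (A \<inter> {..<k})) \<longlonglongrightarrow> R"
    using assms by (simp add: sums_def sum_rate_Int)
  have le: "prob {\<omega> \<in> space M. total A \<omega> \<le> of_nat n} = (\<Sum>i\<le>n. R ^ i / fact i * exp (- R))" for n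
    by (rule LIMSEQ_unique[OF prob_total_le_limit]) (intro tendsto_intros lim, simp)
  show ?thesis
  proof (cases n)
    case 0
    then show ?thesis using le[of 0] by simp
  next
    case (Suc k)
    have "{\<omega> \<in> space M. total A \<omega> \<le> of_nat (Suc k)} =
        {\<omega> \<in> space M. total A \<omega> \<le> of_nat k} \<union> {\<omega> \<in> space M. total A \<omega> = of_nat (Suc k)}"
      unfolding total_le_Suc_iff by blast
    also have "prob \<dots> = prob {\<omega> \<in> space M. total A \<omega> \<le> of_nat k} +
        prob {\<omega> \<in> space M. total A \<omega> = of_nat (Suc k)}"
      by (rule finite_measure_Union) (auto simp del: of_nat_Suc)
    finally show ?thesis unfolding Suc le by simp
  qed
qed

text \<open>As the truncated rate tends to infinity, a power of it times \<open>exp\<close> of its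
  negative tends to 0. Hence every event \<open>total A \<omega> \<le> of_nat n\<close> is
  null.\<close>

lemma AE_total_infinite:
  assumes "\<not> summable (\<lambda>m. if m \<in> A then r m else 0)"
  shows "AE \<omega> in M. total A \<omega> = \<infinity>"
proof -
  \<comment> \<open>Increasing partial sums either tend to infinity or are bounded, and a bounded
    nonnegative series would be summable.\<close>
  have lim: "filterlim (\<lambda>k. sum r (A \<inter> {..<k})) at_top sequentially"
  proof (rule ccontr)
    assume nlim: "\<not> ?thesis"
    have inc: "incseq (\<lambda>k. sum r (A \<inter> {..<k}))"
      by (intro incseq_SucI sum_mono2) (auto simp: rate_nonneg)
    have "\<exists>b. \<forall>k. sum r (A \<inter> {..<k}) \<le> b"
    proof (rule ccontr)
      assume unb: "\<not> ?thesis"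
      have "filterlim (\<lambda>k. sum r (A \<inter> {..<k})) at_top sequentially"
        unfolding filterlim_at_top eventually_sequentially
      proof
        fix Z
        obtain k0 where "Z \<le> sum r (A \<inter> {..<k0})" using unb by (meson linear)
        then show "\<exists>k0. \<forall>k\<ge>k0. Z \<le> sum r (A \<inter> {..<k})"
          using inc by (meson incseqD order_trans)
      qed
      with nlim show False by simp
    qed
    then obtain b where "\<And>k. sum r (A \<inter> {..<k}) \<le> b" by blast
    then have "summable (\<lambda>m. if m \<in> A then r m else 0)"
      unfolding sum_rate_Int[symmetric]
      by (intro bounded_imp_summable[of _ b])
        (simp_all add: rate_nonneg flip: lessThan_Suc_atMost del: sum.lessThan_Suc)
    with assms show False by simp
  qed
  have zero: "prob {\<omega> \<in> space M. total A \<omega> \<le> of_nat n} = 0" for n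
  proof (rule LIMSEQ_unique[OF prob_total_le_limit])
    have "((\<lambda>x::real. \<Sum>i\<le>n. x ^ i / exp x * (1 / fact i)) \<longlongrightarrow> (\<Sum>i\<le>n. 0 * (1 / fact i))) at_top"
      by (intro tendsto_intros tendsto_power_div_exp_0)
    from filterlim_compose[OF this lim]
    show "(\<lambda>k. \<Sum>i\<le>n. sum r (A \<inter> {..<k}) ^ i / fact i * exp (- sum r (A \<inter> {..<k}))) \<longlonglongrightarrow> 0"
      by (simp add: exp_minus field_simps)
  qed
  have "AE \<omega> in M. \<not> total A \<omega> \<le> of_nat n" for n
    using zero[of n] by (subst (asm) prob_eq_0) auto
  then have "AE \<omega> in M. \<forall>n. \<not> total A \<omega> \<le> of_nat n"
    by (simp add: AE_all_countable)
  then show ?thesis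
  proof eventually_elim
    case (elim \<omega>)
    show ?case
    proof (rule ccontr)
      assume "total A \<omega> \<noteq> \<infinity>"
      then have "total A \<omega> < top" by (simp add: top.not_eq_extremum)
      then obtain n where "total A \<omega> < of_nat n" using ennreal_Ex_less_of_nat by blast
      with elim show False by (meson less_imp_le)
    qed
  qed
qed

text \<open>An index \<open>j\<close> codes a pair \<open>(m, i)\<close> and stands for the copy
  number \<open>i\<close> of the atom \<open>K m\<close>, which is present when
  \<open>i < N m \<omega>\<close>.\<close>

lemma point_count_eq_total:
  "point_count (\<lambda>\<omega>. {j. snd (prod_decode j) < N (fst (prod_decode j)) \<omega>})
     (\<lambda>j \<omega>. K (fst (prod_decode j))) A = total {m. K m \<in> A}"
proof
  fix \<omega>
  let ?J = "\<lambda>m. if K m \<in> A then prod_encode ` ({m} \<times> {..<N m \<omega>}) else {}"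
  have "{j \<in> {j. snd (prod_decode j) < N (fst (prod_decode j)) \<omega>}. K (fst (prod_decode j)) \<in> A} = (\<Union>m. ?J m)"
  proof safe
    fix j assume "snd (prod_decode j) < N (fst (prod_decode j)) \<omega>" "K (fst (prod_decode j)) \<in> A"
    then show "j \<in> (\<Union>m. ?J m)"
      by (intro UN_I[of "fst (prod_decode j)"])
        (auto intro!: image_eqI[of _ _ "prod_decode j"] simp: mem_Times_iff)
  qed (auto split: if_splits)
  then have "point_count (\<lambda>\<omega>. {j. snd (prod_decode j) < N (fst (prod_decode j)) \<omega>})
      (\<lambda>j \<omega>. K (fst (prod_decode j))) A \<omega> = emeasure (count_space UNIV) (\<Union>m. ?J m)"
    by (simp add: point_count_def)
  also have "\<dots> = (\<Sum>m. emeasure (count_space UNIV) (?J m))"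
    by (rule suminf_emeasure[symmetric]) (auto simp: disjoint_family_on_def prod_encode_eq split: if_splits)
  also have "\<dots> = total {m. K m \<in> A} \<omega>"
    unfolding total_def
  proof (intro suminf_cong)
    fix m
    have "card (prod_encode ` ({m} \<times> {..<N m \<omega>})) = N m \<omega>"
      by (subst card_image) (auto simp: inj_on_def prod_encode_eq card_cartesian_product)
    then show "emeasure (count_space UNIV) (?J m) = (if m \<in> {m. K m \<in> A} then of_nat (N m \<omega>) else 0)"
      by (auto simp: emeasure_count_space)
  qed
  finally show "point_count (\<lambda>\<omega>. {j. snd (prod_decode j) < N (fst (prod_decode j)) \<omega>})
      (\<lambda>j \<omega>. K (fst (prod_decode j))) A \<omega> = total {m. K m \<in> A} \<omega>" .
qed

text \<open>Every count is a \<open>total\<close>. Summability of the rates of the atoms in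
  \<open>A\<close> separates finite from infinite intensity, and disjoint sets select disjoint sets
  of indices.\<close>

lemma poisson_process_atomic:
  assumes K: "\<And>m. K m \<in> space \<nu>"
    and \<nu>: "\<And>A. A \<in> sets \<nu> \<Longrightarrow> emeasure \<nu> A = (\<Sum>m. ennreal (if K m \<in> A then r m else 0))"
  shows "poisson_process M \<nu> (\<lambda>\<omega>. {j. snd (prod_decode j) < N (fst (prod_decode j)) \<omega>})
     (\<lambda>j \<omega>. K (fst (prod_decode j)))"
proof -
  have "AE \<omega> in M. total {m. K m \<in> A} \<omega> = \<infinity>" if "A \<in> sets \<nu>" "emeasure \<nu> A = \<infinity>" for A
  proof (rule AE_total_infinite)
    show "\<not> summable (\<lambda>m. if m \<in> {m. K m \<in> A} then r m else 0)"
    proof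
      assume "summable (\<lambda>m. if m \<in> {m. K m \<in> A} then r m else 0)"
      then have "(\<Sum>m. ennreal (if K m \<in> A then r m else 0)) \<noteq> top"
        by (intro ennreal_suminf_neq_top) (auto simp: rate_nonneg)
      with that \<nu> show False by simp
    qed
  qed
  moreover have "prob {\<omega> \<in> space M. total {m. K m \<in> A} \<omega> = of_nat n} =
      measure \<nu> A ^ n / fact n * exp (- measure \<nu> A)"
    if A: "A \<in> sets \<nu>" and fin: "emeasure \<nu> A < \<infinity>" for A n
  proof (rule prob_total_eq)
    let ?r = "\<lambda>m. if K m \<in> A then r m else 0"
    have "summable ?r"
      using fin \<nu>[OF A] by (intro summable_suminf_not_top) (auto simp: rate_nonneg)
    moreover from this have "emeasure \<nu> A = ennreal (suminf ?r)"
      unfolding \<nu>[OF A] by (intro suminf_ennreal2) (auto simp: rate_nonneg)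
    then have "measure \<nu> A = suminf ?r"
      using \<open>summable ?r\<close> by (simp add: measure_def suminf_nonneg rate_nonneg)
    ultimately show "(\<lambda>m. if m \<in> {m. K m \<in> A} then r m else 0) sums measure \<nu> A"
      by (simp add: summable_sums)
  qed
  moreover have "indep_vars (\<lambda>_. borel) (\<lambda>l. total {m. K m \<in> A l}) {..<k}"
    if "disjoint_family_on A {..<k}" for A and k :: nat
    using that by (intro indep_vars_total) (auto simp: disjoint_family_on_def)
  ultimately show ?thesis
    unfolding poisson_process_def point_count_eq_total
    using K by (auto simp: prob_space_axioms)
qed

end

text \<open>The injection \<open>e\<close> transports the canonical product space to a sample space of a prescribed
  type, as needed for \<open>represented_by\<close>.\<close>

lemma poisson_family_exists:
  fixes r :: "nat \<Rightarrow> real" and e :: "(nat \<Rightarrow> nat) \<Rightarrow> 'v"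
  assumes r: "\<And>m. 0 \<le> r m" and e: "inj e"
  shows "\<exists>(\<Omega> :: 'v measure) N. poisson_family \<Omega> N r"
proof -
  \<comment> \<open>Rate 0 gets the point mass at 0, in agreement with the formula of
    \<open>poisson_family\<close> at \<open>0 ^ 0 = 1\<close>.\<close>
  define p where "p m = (if r m = 0 then return_pmf 0 else poisson_pmf (r m))" for m
  have pmf_p: "pmf (p m) n = r m ^ n / fact n * exp (- r m)" for m n
    using r[of m] by (auto simp: p_def indicator_def power_0_left)
  define P where "P = PiM UNIV (\<lambda>m. measure_pmf (p m))"
  interpret P: product_prob_space "\<lambda>m. measure_pmf (p m)" UNIV by unfold_locales
  have sets_P: "sets P = sets (PiM UNIV (\<lambda>_. count_space UNIV))"
    unfolding P_def by (rule sets_PiM_cong) auto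
  have space_P: "space P = UNIV" by (simp add: P_def space_PiM PiE_def)
  \<comment> \<open>Pulling the \<sigma>-algebra back along \<open>inv e\<close> makes both
    \<open>e\<close> and \<open>inv e\<close> measurable, and \<open>inv e \<circ> e\<close> is the
    identity, so nothing is lost.\<close>
  define \<Omega> where "\<Omega> = distr P (vimage_algebra UNIV (inv e) P) e"
  have e_measurable: "e \<in> P \<rightarrow>\<^sub>M vimage_algebra UNIV (inv e) P"
    by (rule measurable_vimage_algebra2) (auto simp: inv_f_f[OF e])
  interpret prob_space \<Omega>
    unfolding \<Omega>_def P_def[symmetric] using P.P.prob_space_distr e_measurable by (simp add: P_def)
  have inv_measurable: "inv e \<in> \<Omega> \<rightarrow>\<^sub>M P"
    unfolding \<Omega>_def measurable_distr_eq1 by (rule measurable_vimage_algebra1) (simp add: space_P)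
  let ?N = "\<lambda>m \<omega>. inv e \<omega> m"
  have component: "(\<lambda>f. f m) \<in> P \<rightarrow>\<^sub>M count_space UNIV" for m
    unfolding measurable_cong_sets[OF sets_P refl] by (rule measurable_component_singleton) simp
  have N_measurable: "?N m \<in> \<Omega> \<rightarrow>\<^sub>M count_space UNIV" for m
    by (rule measurable_compose[OF inv_measurable component])
  have distr_N: "distr \<Omega> (count_space UNIV) (?N m) = measure_pmf (p m)" for m
  proof -
    have "distr \<Omega> (count_space UNIV) (?N m) = distr P (count_space UNIV) (?N m \<circ> e)"
      unfolding \<Omega>_def using N_measurable[of m] e_measurable
      by (intro distr_distr) (simp_all add: \<Omega>_def)
    also have "\<dots> = distr P (measure_pmf (p m)) (\<lambda>f. f m)"
      by (intro distr_cong) (auto simp: inv_f_f[OF e])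
    also have "\<dots> = measure_pmf (p m)"
      unfolding P_def by (rule P.PiM_component) simp
    finally show ?thesis .
  qed
  have "poisson_family \<Omega> ?N r"
  proof
    \<comment> \<open>Independence is checked as equality of the joint law with the product of the
      marginals; both are \<open>P\<close>.\<close>
    have "distr \<Omega> (PiM UNIV (\<lambda>_. count_space UNIV)) (\<lambda>\<omega>. \<lambda>m\<in>UNIV. ?N m \<omega>) =
        distr P (PiM UNIV (\<lambda>_. count_space UNIV)) (inv e \<circ> e)"
      unfolding \<Omega>_def using inv_measurable e_measurable
      by (simp add: \<Omega>_def distr_distr measurable_cong_sets[OF refl sets_P] restrict_def)
    also have "\<dots> = distr P P (\<lambda>f. f)"
      using sets_P by (intro distr_cong) (auto simp: inv_f_f[OF e])
    also have "\<dots> = PiM UNIV (\<lambda>m. distr \<Omega> (count_space UNIV) (?N m))"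
      by (simp add: distr_id2 distr_N P_def)
    finally show "indep_vars (\<lambda>_. count_space UNIV) ?N UNIV"
      using N_measurable by (subst indep_vars_iff_distr_eq_PiM') auto
    fix m n
    have "prob {\<omega> \<in> space \<Omega>. ?N m \<omega> = n} = measure (distr \<Omega> (count_space UNIV) (?N m)) {n}"
      by (subst measure_distr[OF N_measurable]) (auto intro!: arg_cong[where f = prob])
    then show "prob {\<omega> \<in> space \<Omega>. ?N m \<omega> = n} = r m ^ n / fact n * exp (- r m)"
      by (simp add: distr_N measure_pmf_single pmf_p)
  qed (rule r)
  then show ?thesis by blast
qed

section \<open>Renewal processes\<close>

text \<open>Stationarity enters as the constant probability of a zero, non-triviality as the almost
  sure existence of one.\<close>

locale renewal = prob_space M for M :: "'w measure" +
  fixes X :: "int \<Rightarrow> 'w \<Rightarrow> nat" and b :: "nat \<Rightarrow> real"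
  assumes measurable_X: "X i \<in> M \<rightarrow>\<^sub>M count_space {0, 1}"
    and AE_zero: "AE \<omega> in M. \<exists>i. X i \<omega> = 0"
    and prob_zero: "prob (zeros M X {k}) = prob (zeros M X {0})"
    and prob_zero_pos: "prob (zeros M X {0}) > 0"
    and b_nonneg: "n \<ge> 1 \<Longrightarrow> 0 \<le> b n"
    and b_sums: "(\<lambda>n. b (Suc n)) sums 1"
    and cond_next_zero: "n \<ge> 1 \<Longrightarrow> AE \<omega> in M. X k \<omega> = 0 \<longrightarrow>
       real_cond_exp M (past_algebra M X k) (indicator (next_zero_event M X k n)) \<omega> = b n"
begin

abbreviation Z :: "int set \<Rightarrow> 'w set" where
  "Z \<equiv> zeros M X"

lemma Z_insert: "Z (insert i A) = Z A \<inter> Z {i}"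
  by (auto simp: zeros_def)

lemma Z_sets [measurable]: "Z A \<in> events"
  using measurable_X by (intro zeros_sets) auto

lemma space_past: "space (past_algebra M X k) = space M"
  by (simp add: past_algebra_def)

lemma measurable_past:
  assumes "i \<le> k"
  shows "X i \<in> past_algebra M X k \<rightarrow>\<^sub>M count_space {0, 1}"
proof -
  have "(\<lambda>\<omega> (i::nat). X (k - int i) \<omega>) \<in> past_algebra M X k \<rightarrow>\<^sub>M bit_space"
    unfolding past_algebra_def
    by (rule measurable_vimage_algebra1)
      (use measurable_space[OF measurable_X] in \<open>auto simp: space_bit_space\<close>)
  from measurable_compose[OF this measurable_bit_space_component[of "nat (k - i)"]]
  show ?thesis using assms by simp
qed

lemma Z_past: "\<forall>i\<in>A. i \<le> k \<Longrightarrow> Z A \<in> sets (past_algebra M X k)"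
  using zeros_sets[of A X "past_algebra M X k"] measurable_past
  by (auto simp: zeros_def space_past)

lemma past_mono:
  assumes "k \<le> l"
  shows "sets (past_algebra M X k) \<subseteq> sets (past_algebra M X l)"
  unfolding past_algebra_def[of M X k]
  using assms by (intro sets_image_in_sets measurable_bit_spaceI measurable_past) (auto simp: space_past)

lemma past_events: "sets (past_algebra M X k) \<subseteq> events"
  unfolding past_algebra_def
  by (intro sets_image_in_sets measurable_bit_spaceI measurable_X) simp

section \<open>The next zero after a given one\<close>

abbreviation next_zero :: "int \<Rightarrow> nat \<Rightarrow> 'w set" where
  "next_zero \<equiv> next_zero_event M X"

lemma next_zero_eq: "next_zero k n = Z {k + int n} - (\<Union>j\<in>{1..<n}. Z {k + int j})"
  by (auto simp: next_zero_event_def zeros_def)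

lemma next_zero_past: "next_zero k n \<in> sets (past_algebra M X (k + int n))"
  unfolding next_zero_eq
  by (intro sets.Diff sets.finite_UN Z_past) auto

lemma next_zero_sets [measurable]: "next_zero k n \<in> events"
  using next_zero_past past_events by blast

lemma next_zero_disjoint:
  assumes "m \<ge> 1" "n \<ge> 1" "m \<noteq> n"
  shows "next_zero k m \<inter> next_zero k n = {}"
  using assms by (cases "m < n") (force simp: next_zero_event_def)+

text \<open>The integrated form of the renewal property: the conditional expectation is almost
  surely the constant \<open>b n\<close> on \<open>Z {k}\<close>, hence on \<open>E\<close>, and
  \<open>E\<close> lies in the conditioning \<sigma>-algebra.\<close>

lemma prob_next_zero:
  assumes E: "E \<in> sets (past_algebra M X k)" "E \<subseteq> Z {k}" and n: "n \<ge> 1"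
  shows "prob (E \<inter> next_zero k n) = b n * prob E"
proof -
  interpret F: finite_measure_subalgebra M "past_algebra M X k"
    by unfold_locales (auto simp: subalgebra_def space_past past_events)
  have EM: "E \<in> events" using E past_events by blast
  let ?f = "indicator (next_zero k n) :: 'w \<Rightarrow> real"
  have "prob (E \<inter> next_zero k n) = (\<integral>\<omega>. indicator (E \<inter> next_zero k n) \<omega> \<partial>M)"
    using EM by simp
  also have "\<dots> = (\<integral>\<omega>\<in>E. ?f \<omega> \<partial>M)"
    by (simp add: set_lebesgue_integral_def indicator_inter_arith)
  also have "\<dots> = (\<integral>\<omega>\<in>E. real_cond_exp M (past_algebra M X k) ?f \<omega> \<partial>M)"
    by (rule F.real_cond_exp_intA) (use E in \<open>auto intro!: integrable_real_indicator simp: emeasure_eq_measure\<close>)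
  also have "\<dots> = (\<integral>\<omega>. b n * indicator E \<omega> \<partial>M)"
    unfolding set_lebesgue_integral_def
  proof (rule integral_cong_AE)
    show "AE \<omega> in M. indicator E \<omega> *\<^sub>R real_cond_exp M (past_algebra M X k) ?f \<omega> = b n * indicator E \<omega>"
      using cond_next_zero[OF n, of k]
      by eventually_elim (use E in \<open>auto simp: zeros_def indicator_def\<close>)
  qed (use EM in auto)
  also have "\<dots> = b n * prob E"
    using EM by simp
  finally show ?thesis .
qed

lemma Z_decompose_next_zero:
  assumes "j \<ge> 1"
  shows "Z {k + int j} = (\<Union>n\<in>{1..j}. Z {k + int j} \<inter> next_zero k n)"
proof safe
  fix \<omega> assume \<omega>: "\<omega> \<in> Z {k + int j}"
  let ?P = "\<lambda>n. n \<ge> 1 \<and> X (k + int n) \<omega> = 0"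
  have P: "?P j" using \<omega> assms by (auto simp: zeros_def)
  let ?n = "LEAST n. ?P n"
  have "?P ?n" "?n \<le> j" using LeastI[of ?P, OF P] Least_le[of ?P, OF P] by auto
  moreover have "\<not> ?P m" if "m < ?n" for m using not_less_Least[OF that] .
  ultimately show "\<omega> \<in> (\<Union>n\<in>{1..j}. Z {k + int j} \<inter> next_zero k n)"
    using \<omega> by (intro UN_I[of ?n]) (auto simp: next_zero_event_def zeros_def)
qed

text \<open>Split according to the first zero \<open>k + n\<close> after \<open>k\<close>. The event
  \<open>E \<inter> next_zero k n\<close> belongs to the past of \<open>k + n\<close>, from where
  the distance \<open>j - n\<close> is smaller. The factor is uniform in \<open>k\<close> and
  \<open>E\<close>, so one choice of \<open>E\<close> suffices to compute it.\<close>

lemma prob_zero_after_factor: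
  "\<exists>v. \<forall>k. \<forall>E\<in>sets (past_algebra M X k). E \<subseteq> Z {k} \<longrightarrow> prob (E \<inter> Z {k + int j}) = v * prob E"
proof (induction j rule: less_induct)
  case (less j)
  show ?case
  proof (cases "j = 0")
    case True
    then have "prob (E \<inter> Z {k + int j}) = 1 * prob E" if "E \<subseteq> Z {k}" for E k
      using that by (simp add: Int_absorb2)
    then show ?thesis by blast
  next
    case False
    then have j: "j \<ge> 1" by simp
    from less have "\<exists>v. \<forall>i<j. \<forall>k. \<forall>E\<in>sets (past_algebra M X k). E \<subseteq> Z {k} \<longrightarrow>
        prob (E \<inter> Z {k + int i}) = v i * prob E"
      by metis
    then obtain v where v: "\<And>i k E. i < j \<Longrightarrow> E \<in> sets (past_algebra M X k) \<Longrightarrow> E \<subseteq> Z {k} \<Longrightarrow>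
        prob (E \<inter> Z {k + int i}) = v i * prob E"
      by blast
    have "prob (E \<inter> Z {k + int j}) = (\<Sum>n\<in>{1..j}. v (j - n) * b n) * prob E"
      if E: "E \<in> sets (past_algebra M X k)" "E \<subseteq> Z {k}" for k E
    proof -
      have EM[measurable]: "E \<in> events" using E past_events by blast
      have "E \<inter> Z {k + int j} = (\<Union>n\<in>{1..j}. (E \<inter> next_zero k n) \<inter> Z {k + int j})"
        using Z_decompose_next_zero[OF j, of k] by blast
      also have "prob \<dots> = (\<Sum>n\<in>{1..j}. prob ((E \<inter> next_zero k n) \<inter> Z {k + int j}))"
      proof (rule finite_measure_finite_Union)
        show "disjoint_family_on (\<lambda>n. (E \<inter> next_zero k n) \<inter> Z {k + int j}) {1..j}"
          using next_zero_disjoint[of _ _ k] by (fastforce simp: disjoint_family_on_def)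
      qed auto
      also have "\<dots> = (\<Sum>n\<in>{1..j}. v (j - n) * b n * prob E)"
      proof (intro sum.cong refl)
        fix n assume n: "n \<in> {1..j}"
        have "E \<inter> next_zero k n \<in> sets (past_algebra M X (k + int n))"
          using E next_zero_past past_mono[of k "k + int n"] by auto
        moreover have "E \<inter> next_zero k n \<subseteq> Z {k + int n}"
          by (auto simp: next_zero_eq)
        ultimately have "prob ((E \<inter> next_zero k n) \<inter> Z {(k + int n) + int (j - n)}) =
            v (j - n) * prob (E \<inter> next_zero k n)"
          using n by (intro v) auto
        moreover have "(k + int n) + int (j - n) = k + int j" using n by auto
        ultimately show "prob ((E \<inter> next_zero k n) \<inter> Z {k + int j}) = v (j - n) * b n * prob E"
          using n prob_next_zero[OF E, of n] by simp
      qed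
      finally show ?thesis by (simp add: sum_distrib_right)
    qed
    then show ?thesis by blast
  qed
qed

section \<open>Product formula for joint zeros\<close>

definition c :: "nat \<Rightarrow> real" where
  "c k = prob (Z {0, int k})"

lemma c_nonneg: "0 \<le> c k" and c_le_1: "c k \<le> 1"
  by (simp_all add: c_def)

lemma c_0: "c 0 = prob (Z {0})" and c_0_pos: "c 0 > 0"
  using prob_zero_pos by (simp_all add: c_def)

lemma prob_zero_after:
  assumes "E \<in> sets (past_algebra M X k)" "E \<subseteq> Z {k}"
  shows "prob (E \<inter> Z {k + int j}) = prob E * c j / c 0"
proof -
  from prob_zero_after_factor[of j] obtain v where v:
    "\<And>k E. E \<in> sets (past_algebra M X k) \<Longrightarrow> E \<subseteq> Z {k} \<Longrightarrow> prob (E \<inter> Z {k + int j}) = v * prob E"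
    by blast
  \<comment> \<open>The choice \<open>E = Z {0}\<close> identifies the uniform factor.\<close>
  have "c j = v * c 0"
    using v[of "Z {0}" 0] by (auto simp: c_def Z_past Z_insert[of 0 "{int j}"] Int_commute)
  with v[OF assms] c_0_pos show ?thesis by simp
qed

text \<open>Only the largest zero \<open>m\<close> so far influences a later one. The case
  \<open>m = k\<close> is included, with factor \<open>c 0 / c 0 = 1\<close>.\<close>

lemma prob_zeros_insert:
  assumes "m \<in> A" "\<forall>i\<in>A. i \<le> m" "m \<le> k"
  shows "prob (Z (insert k A)) = prob (Z A) * c (nat (k - m)) / c 0"
  using prob_zero_after[of "Z A" m "nat (k - m)"] assms
  by (simp add: Z_insert[of k A] Z_past) (auto simp: zeros_def)

section \<open>Tails of the waiting time and the renewal equation\<close>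

definition no_zero :: "int \<Rightarrow> nat \<Rightarrow> 'w set" where
  "no_zero k n = {\<omega> \<in> space M. \<forall>i\<in>{1..n}. X (k + int i) \<omega> \<noteq> 0}"

text \<open>The probability that the gap following a zero is longer than \<open>n\<close>.\<close>

definition tail :: "nat \<Rightarrow> real" where
  "tail n = 1 - (\<Sum>i\<in>{1..n}. b i)"

lemma no_zero_eq: "no_zero k n = space M - (\<Union>i\<in>{1..n}. Z {k + int i})"
  by (auto simp: no_zero_def zeros_def)

lemma no_zero_sets [measurable]: "no_zero k n \<in> events"
  unfolding no_zero_eq by measurable

lemma tail_nonneg: "0 \<le> tail n"
proof -
  have "(\<Sum>i\<in>{1..n}. b i) = (\<Sum>i<n. b (Suc i))"
    by (rule sum.reindex_bij_witness[of _ Suc "\<lambda>i. i - 1"]) auto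
  also have "\<dots> \<le> (\<Sum>i. b (Suc i))"
    using b_sums b_nonneg by (intro sum_le_suminf) (auto simp: sums_iff)
  finally show ?thesis using b_sums by (simp add: tail_def sums_iff)
qed

lemma prob_no_zero_after:
  assumes E: "E \<in> sets (past_algebra M X k)" "E \<subseteq> Z {k}"
  shows "prob (E \<inter> no_zero k n) = prob E * tail n"
proof -
  have EM[measurable]: "E \<in> events" using E past_events by blast
  \<comment> \<open>The window contains a zero exactly when it contains the first zero after
    \<open>k\<close>, and the events for the first zero are disjoint.\<close>
  have "(\<Union>i\<in>{1..n}. Z {k + int i}) = (\<Union>i\<in>{1..n}. next_zero k i)"
  proof (rule antisym)
    show "(\<Union>i\<in>{1..n}. Z {k + int i}) \<subseteq> (\<Union>i\<in>{1..n}. next_zero k i)"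
    proof
      fix \<omega> assume "\<omega> \<in> (\<Union>i\<in>{1..n}. Z {k + int i})"
      then obtain i where i: "i \<in> {1..n}" "\<omega> \<in> Z {k + int i}" by blast
      then have "i \<ge> 1" by simp
      from Z_decompose_next_zero[OF this, of k] i(2)
      obtain l where "l \<in> {1..i}" "\<omega> \<in> next_zero k l" by blast
      with i show "\<omega> \<in> (\<Union>i\<in>{1..n}. next_zero k i)" by (intro UN_I[of l]) auto
    qed
  qed (auto simp: next_zero_eq)
  then have "E \<inter> no_zero k n = E - (\<Union>i\<in>{1..n}. E \<inter> next_zero k i)"
    unfolding no_zero_eq using sets.sets_into_space[OF EM] by auto
  also have "prob \<dots> = prob E - prob (\<Union>i\<in>{1..n}. E \<inter> next_zero k i)"
    by (rule finite_measure_Diff) auto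
  also have "prob (\<Union>i\<in>{1..n}. E \<inter> next_zero k i) = (\<Sum>i\<in>{1..n}. prob (E \<inter> next_zero k i))"
  proof (rule finite_measure_finite_Union)
    show "disjoint_family_on (\<lambda>n. E \<inter> next_zero k n) {1..n}"
      using next_zero_disjoint[of _ _ k] by (fastforce simp: disjoint_family_on_def)
  qed auto
  also have "\<dots> = (\<Sum>i\<in>{1..n}. b i * prob E)"
    by (intro sum.cong refl prob_next_zero E) auto
  finally show ?thesis
    by (simp add: tail_def algebra_simps sum_distrib_left)
qed

text \<open>Decomposition by the last zero in the window from \<open>k\<close> to
  \<open>k + n\<close>. After that zero the window contributes only the factor
  \<open>tail (n - i)\<close>.\<close>

lemma prob_last_zero:
  assumes [measurable]: "E \<in> events"
  shows "prob (E \<inter> (\<Union>i\<le>n. Z {k + int i})) =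
    (\<Sum>i\<le>n. prob (E \<inter> Z {k + int i} \<inter> no_zero (k + int i) (n - i)))"
proof -
  let ?D = "\<lambda>i. E \<inter> Z {k + int i} \<inter> no_zero (k + int i) (n - i)"
  have "E \<inter> (\<Union>i\<le>n. Z {k + int i}) = (\<Union>i\<le>n. ?D i)"
  proof (intro antisym subsetI)
    fix \<omega> assume "\<omega> \<in> E \<inter> (\<Union>i\<le>n. Z {k + int i})"
    then have \<omega>: "\<omega> \<in> E" "\<omega> \<in> space M" and ex: "{i. i \<le> n \<and> X (k + int i) \<omega> = 0} \<noteq> {}"
      by (auto simp: zeros_def)
    let ?S = "{i. i \<le> n \<and> X (k + int i) \<omega> = 0}"
    define m where "m = Max ?S"
    have fin: "finite ?S" by simp
    have m: "m \<le> n" "X (k + int m) \<omega> = 0" using Max_in[OF fin ex] by (auto simp: m_def)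
    have "X (k + int m + int i) \<omega> \<noteq> 0" if "i \<in> {1..n - m}" for i
    proof
      assume "X (k + int m + int i) \<omega> = 0"
      then have "m + i \<in> ?S" using that m by (auto simp: ac_simps)
      then have "m + i \<le> m" unfolding m_def by (rule Max_ge[OF fin])
      with that show False by simp
    qed
    with \<omega> m show "\<omega> \<in> (\<Union>i\<le>n. ?D i)"
      by (intro UN_I[of m]) (auto simp: zeros_def no_zero_def)
  qed auto
  also have "prob \<dots> = (\<Sum>i\<le>n. prob (?D i))"
  proof (rule finite_measure_finite_Union)
    have "?D i \<inter> ?D j = {}" if "i < j" "j \<le> n" for i j
    proof -
      have "j - i \<in> {1..n - i}" "k + int i + int (j - i) = k + int j" using that by auto
      then show ?thesis by (force simp: zeros_def no_zero_def)
    qed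
    then show "disjoint_family_on ?D {..n}"
      unfolding disjoint_family_on_def by (metis Int_commute atMost_iff linorder_neqE_nat)
  qed auto
  finally show ?thesis .
qed

lemma renewal_equation: "(\<Sum>i\<le>n. c i * tail (n - i)) = c 0"
proof -
  have "prob (Z {0} \<inter> (\<Union>i\<le>n. Z {0 + int i})) =
      (\<Sum>i\<le>n. prob (Z {0} \<inter> Z {0 + int i} \<inter> no_zero (0 + int i) (n - i)))"
    by (rule prob_last_zero) measurable
  \<comment> \<open>The term \<open>i = 0\<close> is \<open>Z {0}\<close> itself, so the window
    certainly contains a zero.\<close>
  also have "Z {0} \<inter> (\<Union>i\<le>n. Z {0 + int i}) = Z {0}" by force
  also have "(\<Sum>i\<le>n. prob (Z {0} \<inter> Z {0 + int i} \<inter> no_zero (0 + int i) (n - i))) =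
      (\<Sum>i\<le>n. c i * tail (n - i))"
  proof (intro sum.cong refl)
    fix i
    have "Z {0} \<inter> Z {0 + int i} = Z {0, int i}" by (auto simp: zeros_def)
    then show "prob (Z {0} \<inter> Z {0 + int i} \<inter> no_zero (0 + int i) (n - i)) = c i * tail (n - i)"
      using prob_no_zero_after[of "Z {0, int i}" "int i" "n - i"]
      by (auto simp: c_def Z_past)
  qed
  finally show ?thesis by (simp add: c_0)
qed

lemma prob_zero_in_window: "prob (\<Union>i\<le>n. Z {k + int i}) = (\<Sum>i\<le>n. c 0 * tail i)"
proof -
  have "prob (\<Union>i\<le>n. Z {k + int i}) = prob (space M \<inter> (\<Union>i\<le>n. Z {k + int i}))"
    by (rule arg_cong[where f = prob]) (auto simp: zeros_def)
  also have "\<dots> = (\<Sum>i\<le>n. prob (space M \<inter> Z {k + int i} \<inter> no_zero (k + int i) (n - i)))"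
    by (rule prob_last_zero) simp
  also have "\<dots> = (\<Sum>i\<le>n. c 0 * tail (n - i))"
  proof (intro sum.cong refl)
    fix i
    have "space M \<inter> Z {k + int i} = Z {k + int i}" by (auto simp: zeros_def)
    then show "prob (space M \<inter> Z {k + int i} \<inter> no_zero (k + int i) (n - i)) = c 0 * tail (n - i)"
      using prob_no_zero_after[of "Z {k + int i}" "k + int i" "n - i"]
      by (simp add: Z_past prob_zero[of "k + int i"] c_0)
  qed
  also have "\<dots> = (\<Sum>i\<le>n. c 0 * tail i)"
    by (rule sum.nat_diff_reindex[of "\<lambda>i. c 0 * tail i" "Suc n", simplified lessThan_Suc_atMost, simplified])
  finally show ?thesis .
qed

text \<open>The windows from \<open>- m\<close> to \<open>m\<close> exhaust the integers and almost
  surely some zero exists, so the probability of a zero in the window tends to 1. Equivalently, the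
  mean gap is \<open>1 / c 0\<close>.\<close>

lemma tail_sums: "(\<lambda>i. c 0 * tail i) sums 1"
proof -
  let ?W = "\<lambda>m. \<Union>i\<le>2 * m. Z {- int m + int i}"
  have "(\<lambda>m. prob (?W m)) \<longlonglongrightarrow> prob (\<Union>m. ?W m)"
  proof (rule finite_Lim_measure_incseq)
    show "incseq ?W"
    proof (intro incseq_SucI subsetI)
      fix m \<omega> assume "\<omega> \<in> ?W m"
      then obtain i where "i \<le> 2 * m" "\<omega> \<in> Z {- int m + int i}" by blast
      then show "\<omega> \<in> ?W (Suc m)" by (intro UN_I[of "Suc i"]) auto
    qed
  qed auto
  moreover have "prob (\<Union>m. ?W m) = 1"
  proof -
    have "AE \<omega> in M. \<omega> \<in> (\<Union>m. ?W m)"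
      using AE_zero AE_space
    proof eventually_elim
      case (elim \<omega>)
      then obtain i where i: "X i \<omega> = 0" by blast
      have "\<omega> \<in> ?W (nat \<bar>i\<bar>)"
        using i elim by (intro UN_I[of "nat (i + \<bar>i\<bar>)"]) (auto simp: zeros_def)
      then show ?case by blast
    qed
    then show ?thesis by (subst prob_eq_1) auto
  qed
  ultimately have "(\<lambda>m. \<Sum>i\<le>2 * m. c 0 * tail i) \<longlonglongrightarrow> 1"
    by (simp only: prob_zero_in_window)
  \<comment> \<open>The symmetric windows give only the partial sums up to \<open>2 * m\<close>;
    summability extends their limit to the whole series.\<close>
  moreover have "summable (\<lambda>i. c 0 * tail i)"
  proof (rule bounded_imp_summable)
    show "0 \<le> c 0 * tail n" for n by (simp add: c_nonneg tail_nonneg)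
    show "(\<Sum>i\<le>n. c 0 * tail i) \<le> 1" for n
      unfolding prob_zero_in_window[of 0 n, symmetric] by simp
  qed
  then have "(\<lambda>n. \<Sum>i\<le>n. c 0 * tail i) \<longlonglongrightarrow> (\<Sum>i. c 0 * tail i)"
    by (rule summable_LIMSEQ')
  then have "((\<lambda>n. \<Sum>i\<le>n. c 0 * tail i) \<circ> (\<lambda>m. 2 * m)) \<longlonglongrightarrow> (\<Sum>i. c 0 * tail i)"
    by (rule LIMSEQ_subseq_LIMSEQ) (auto simp: strict_mono_def)
  ultimately have "(\<Sum>i. c 0 * tail i) = 1"
    by (auto simp: o_def intro: LIMSEQ_unique)
  with \<open>summable (\<lambda>i. c 0 * tail i)\<close> show ?thesis by (simp add: sums_iff)
qed

text \<open>A gap of length \<open>n\<close> after a zero at 0 produces a zero at \<open>n\<close>,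
  so \<open>b n * c 0 \<le> c n\<close>; not all \<open>b n\<close> vanish.\<close>

lemma exists_c_pos: "\<exists>j\<ge>1. c j > 0"
proof (rule ccontr)
  assume "\<not> ?thesis"
  then have c: "c j = 0" if "j \<ge> 1" for j using c_nonneg[of j] that by force
  have "b (Suc j) = 0" for j
  proof -
    have "b (Suc j) * c 0 = prob (Z {0} \<inter> next_zero 0 (Suc j))"
      using prob_next_zero[of "Z {0}" 0 "Suc j"] by (simp add: Z_past c_0)
    also have "\<dots> \<le> c (Suc j)"
      unfolding c_def by (rule finite_measure_mono[OF _ Z_sets]) (auto simp: next_zero_event_def zeros_def)
    finally have "b (Suc j) * c 0 \<le> 0" using c[of "Suc j"] by simp
    with c_0_pos have "b (Suc j) \<le> 0" by (simp add: mult_le_0_iff)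
    with b_nonneg[of "Suc j"] show ?thesis by simp
  qed
  with b_sums show False by (simp add: sums_iff)
qed

end

lemma renewal_process_imp_renewal:
  assumes X: "renewal_process M X" and pos: "measure M {\<omega> \<in> space M. X 0 \<omega> = 0} > 0"
  shows "\<exists>b. renewal M X b"
proof -
  from X have bit: "bit_process M X" and non: "nontrivial M X" and stat: "stationary M X"
    by (auto simp: renewal_process_def)
  from X obtain b where b: "\<forall>n\<ge>1. 0 \<le> b n" "(\<lambda>n. b (Suc n)) sums 1"
     "\<forall>k. \<forall>n\<ge>1. AE \<omega> in M. X k \<omega> = 0 \<longrightarrow>
           real_cond_exp M (past_algebra M X k) (indicator (next_zero_event M X k n)) \<omega> = b n"
    by (auto simp: renewal_process_def)
  interpret prob_space M using bit by (simp add: bit_process_def)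
  have meas: "X i \<in> M \<rightarrow>\<^sub>M count_space {0, 1}" for i using bit by (simp add: bit_process_def)
  have "renewal M X b"
  proof
    show "AE \<omega> in M. \<exists>i. X i \<omega> = 0" using non by (auto simp: nontrivial_def)
    show "prob (zeros M X {k}) = prob (zeros M X {0})" for k
    proof -
      have "bit_process M (\<lambda>i. X (i + k))" using bit by (simp add: bit_process_def)
      then have "measure M (zeros M (\<lambda>i. X (i + k)) {0}) = measure M (zeros M X {0})"
        using measure_law_zeros[of M X "{0}"] measure_law_zeros[of M "\<lambda>i. X (i + k)" "{0}"] bit stat
        by (simp add: stationary_def)
      then show ?thesis by (simp add: zeros_def)
    qed
    show "prob (zeros M X {0}) > 0" using pos by (simp add: zeros_def)
  qed (use b meas in auto)
  then show ?thesis by blast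
qed

section \<open>Log-convex renewal sequences\<close>

text \<open>Tannery's theorem (dominated convergence for series), applied to the reversed sum with
  terms \<open>u (n - j) * t j\<close>, dominated by \<open>K * t j\<close>.\<close>

lemma convolution_limit:
  fixes u t :: "nat \<Rightarrow> real"
  assumes u: "u \<longlonglongrightarrow> L" and ub: "\<And>n. \<bar>u n\<bar> \<le> K" and t: "\<And>n. 0 \<le> t n" and ts: "t sums T"
  shows "(\<lambda>n. \<Sum>i\<le>n. u i * t (n - i)) \<longlonglongrightarrow> L * T"
proof -
  \<comment> \<open>Extension by 0 beyond \<open>n\<close> turns the finite sums into series over a
    fixed index set.\<close>
  let ?a = "\<lambda>j n. if j \<le> n then u (n - j) * t j else 0"
  have bound: "norm (?a j n) \<le> K * t j" for j n
  proof (cases "j \<le> n")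
    case True
    have "\<bar>u (n - j)\<bar> * t j \<le> K * t j" by (intro mult_right_mono ub t)
    with True t[of j] show ?thesis by (simp add: abs_mult)
  next
    case False
    have "0 \<le> K" using ub[of 0] by linarith
    with False t[of j] show ?thesis by simp
  qed
  have "(\<lambda>n. suminf (\<lambda>j. ?a j n)) \<longlonglongrightarrow> (\<Sum>j. L * t j)"
  proof (rule tannerys_theorem[of ?a "\<lambda>j. L * t j" sequentially "\<lambda>j. K * t j", THEN conjunct2, THEN conjunct2])
    fix j
    have "(\<lambda>n. u (n - j)) \<longlonglongrightarrow> L"
      by (rule LIMSEQ_offset[of _ j]) (simp add: u)
    then have "(\<lambda>n. u (n - j) * t j) \<longlonglongrightarrow> L * t j"
      by (intro tendsto_mult_right)
    moreover have "eventually (\<lambda>n. u (n - j) * t j = ?a j n) sequentially"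
      using eventually_ge_at_top[of j] by eventually_elim simp
    ultimately show "(\<lambda>n. ?a j n) \<longlonglongrightarrow> L * t j" by (rule Lim_transform_eventually)
  next
    show "eventually (\<lambda>(j, n). norm (?a j n) \<le> K * t j) (at_top \<times>\<^sub>F sequentially)"
      using bound by (intro always_eventually) auto
    show "summable (\<lambda>j. K * t j)" using ts by (intro summable_mult) (simp add: sums_iff)
  qed simp
  moreover have "suminf (\<lambda>j. ?a j n) = (\<Sum>i\<le>n. u i * t (n - i))" for n
  proof -
    have "suminf (\<lambda>j. ?a j n) = (\<Sum>j\<le>n. u (n - j) * t j)"
      by (subst suminf_finite[of "{..n}"]) auto
    also have "\<dots> = (\<Sum>i\<le>n. u i * t (n - i))"
      by (rule sum.reindex_bij_witness[of _ "\<lambda>i. n - i" "\<lambda>i. n - i"]) auto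
    finally show ?thesis .
  qed
  moreover have "(\<Sum>j. L * t j) = L * T" using ts by (simp add: suminf_mult sums_iff)
  ultimately show ?thesis by simp
qed

text \<open>For positive \<open>c\<close> and \<open>n \<ge> 1\<close>, the second difference of
  \<open>ln (c n)\<close>. Finite intervals are nonempty, so \<open>n - 1\<close> is never truncated
  for their cardinalities.\<close>

definition log_ratio :: "(nat \<Rightarrow> real) \<Rightarrow> nat \<Rightarrow> real" where
  "log_ratio c n = ln (c (n - 1) * c (n + 1) / (c n)\<^sup>2)"

text \<open>The purely analytic situation: \<open>t\<close> stands for the tail of the waiting
  time.\<close>

locale log_convex_renewal =
  fixes c t :: "nat \<Rightarrow> real"
  assumes log_convex: "k \<ge> 1 \<Longrightarrow> (c k)\<^sup>2 \<le> c (k - 1) * c (k + 1)"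
    and c_bounds: "0 \<le> c k" "c k \<le> 1"
    and c_0: "0 < c 0"
    and c_ex: "\<exists>j\<ge>1. 0 < c j"
    and t: "0 \<le> t n" "(\<lambda>n. c 0 * t n) sums 1"
    and renewal_eq: "(\<Sum>i\<le>n. c i * t (n - i)) = c 0"
begin

text \<open>If \<open>c 1\<close> were 0, log-convexity would force all later terms to be 0, against
  \<open>c_ex\<close>. From two consecutive positive terms it yields positivity of the next.\<close>

lemma c_pos: "0 < c k"
proof -
  have "c 1 > 0"
  proof (rule ccontr)
    assume "\<not> c 1 > 0"
    then have c1: "c 1 = 0" using c_bounds[of 1] by simp
    have "c (Suc k) = 0" for k
    proof (induction k)
      case (Suc k)
      then show ?case using log_convex[of "Suc (Suc k)"] by simp
    qed (use c1 in simp)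
    then have "c k = 0" if "k \<ge> 1" for k using that by (cases k) auto
    then show False using c_ex by auto
  qed
  have "0 < c k \<and> 0 < c (Suc k)"
  proof (induction k)
    case (Suc k)
    then have "0 < (c (Suc k))\<^sup>2" by simp
    also have "\<dots> \<le> c k * c (Suc (Suc k))" using log_convex[of "Suc k"] by simp
    finally show ?case using Suc by (simp add: zero_less_mult_iff)
  qed (use c_0 \<open>c 1 > 0\<close> in simp)
  then show ?thesis by simp
qed

text \<open>By the inequality of arithmetic and geometric means, a nonnegative log-convex sequence
  is convex.\<close>

lemma increments_mono: "c (Suc k) - c k \<le> c (Suc (Suc k)) - c (Suc k)"
proof -
  let ?x = "c k" and ?y = "c (Suc (Suc k))"
  have "(2 * c (Suc k))\<^sup>2 \<le> 4 * (?x * ?y)" using log_convex[of "Suc k"] by (simp add: power_mult_distrib)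
  also have "\<dots> \<le> (?x + ?y)\<^sup>2"
    using zero_le_power2[of "?x - ?y"] unfolding power2_sum power2_diff by linarith
  finally have "2 * c (Suc k) \<le> ?x + ?y"
    by (rule power2_le_imp_le) (simp add: c_bounds)
  then show ?thesis by simp
qed

text \<open>A convex sequence with one positive increment grows at least linearly from there on, but
  \<open>c\<close> is bounded by 1.\<close>

lemma c_decreasing: "c (Suc k) \<le> c k"
proof (rule ccontr)
  define d where "d = c (Suc k) - c k"
  assume "\<not> ?thesis"
  then have d: "d > 0" by (simp add: d_def)
  have inc: "d \<le> c (Suc (k + m)) - c (k + m)" for m
  proof (induction m)
    case (Suc m)
    then show ?case using increments_mono[of "k + m"] by simp
  qed (simp add: d_def)
  have "real m * d \<le> c (k + m)" for m
  proof (induction m)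
    case (Suc m)
    then show ?case using inc[of m] by (simp add: algebra_simps)
  qed (simp add: c_bounds)
  then have "real m * d \<le> 1" for m using c_bounds(2)[of "k + m"] order_trans by blast
  moreover obtain m where "1 < real m * d" using reals_Archimedean3[OF d] by blast
  ultimately show False by (meson not_less)
qed

lemma decseq_c: "decseq c"
  by (intro decseq_SucI c_decreasing)

text \<open>Monotonicity gives a limit \<open>L\<close>. As \<open>t\<close> sums to
  \<open>1 / c 0\<close>, the renewal equation becomes \<open>L / c 0 = c 0\<close> in the
  limit.\<close>

lemma c_limit: "c \<longlonglongrightarrow> (c 0)\<^sup>2"
proof -
  from decseq_c obtain L where L: "c \<longlonglongrightarrow> L"
    by (rule decseq_convergent[of c 0]) (auto simp: c_bounds)
  have "(\<lambda>n. c 0 * t n / c 0) sums (1 / c 0)" by (intro sums_divide t)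
  then have "t sums (1 / c 0)" using c_0 by simp
  then have "(\<lambda>n. \<Sum>i\<le>n. c i * t (n - i)) \<longlonglongrightarrow> L * (1 / c 0)"
    using c_bounds t by (intro convolution_limit[of _ _ 1] L) auto
  then have lim: "(\<lambda>_::nat. c 0) \<longlonglongrightarrow> L * (1 / c 0)" unfolding renewal_eq .
  have "L * (1 / c 0) = c 0" by (rule LIMSEQ_unique[OF lim tendsto_const])
  then have "L = c 0 * c 0" using c_0 by (simp add: divide_eq_eq)
  then have "L = (c 0)\<^sup>2" by (simp only: power2_eq_square)
  from L[unfolded this] show ?thesis .
qed

lemma ln_c_limit: "(\<lambda>n. ln (c n)) \<longlonglongrightarrow> 2 * ln (c 0)"
proof -
  have "(\<lambda>n. ln (c n)) \<longlonglongrightarrow> ln ((c 0)\<^sup>2)"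
    by (rule tendsto_ln[OF c_limit]) (use c_0 in simp)
  then show ?thesis using c_0 by (simp add: ln_realpow)
qed

lemma log_ratio_Suc: "log_ratio c (Suc n) = (ln (c n) - ln (c (Suc n))) - (ln (c (Suc n)) - ln (c (Suc (Suc n))))"
proof -
  have "c k \<noteq> 0" for k using c_pos[of k] by simp
  then show ?thesis
    by (simp add: log_ratio_def ln_div ln_mult ln_realpow c_pos)
qed

lemma log_ratio_nonneg: "0 \<le> log_ratio c (Suc n)"
  using log_convex[of "Suc n"] c_pos[of "Suc n"] by (simp add: log_ratio_def)

text \<open>The second differences telescope, and the first differences tend to 0 because
  \<open>ln (c n)\<close> converges. The sum will be the mass of the intervals that contain
  \<open>e\<close> and have left end \<open>e - s\<close>.\<close>

lemma log_ratio_sums: "(\<lambda>n. log_ratio c (s + n + 1)) sums (ln (c s) - ln (c (Suc s)))"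
proof -
  let ?f = "\<lambda>n. ln (c (s + n)) - ln (c (Suc (s + n)))"
  have "?f \<longlonglongrightarrow> 2 * ln (c 0) - 2 * ln (c 0)"
    using LIMSEQ_ignore_initial_segment[OF ln_c_limit, of s] LIMSEQ_ignore_initial_segment[OF ln_c_limit, of "Suc s"]
    by (intro tendsto_diff) (simp_all add: add.commute[of s])
  from telescope_sums'[OF this]
  have "(\<lambda>n. ?f n - ?f (Suc n)) sums ?f 0" by simp
  moreover have "?f n - ?f (Suc n) = log_ratio c (s + n + 1)" for n
    using log_ratio_Suc[of "s + n"] by simp
  ultimately show ?thesis by simp
qed

lemma ln_increments_sums: "(\<lambda>s. ln (c s) - ln (c (Suc s))) sums (- ln (c 0))"
  using telescope_sums'[OF ln_c_limit] by simp

end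

section \<open>The renewal intensity\<close>

definition interval_mass :: "(nat \<Rightarrow> real) \<Rightarrow> int set \<Rightarrow> ennreal" where
  "interval_mass c K = ennreal (if K \<in> finite_intervals then log_ratio c (card K) else 0)"

lemma sets_renewal_intensity: "sets (renewal_intensity c) = sets nonempty_space"
  by (simp add: renewal_intensity_def)

lemma emeasure_renewal_intensity:
  assumes A: "A \<in> sets nonempty_space"
  shows "emeasure (renewal_intensity c) A = (\<integral>\<^sup>+K. interval_mass c K * indicator A K \<partial>count_space UNIV)"
proof -
  have sub: "A \<subseteq> - {{}}" using sets.sets_into_space[OF A] by (simp add: space_nonempty_space)
  have "renewal_intensity c = distr (density (count_space (- {{}})) (interval_mass c)) nonempty_space (\<lambda>K. K)"
    unfolding renewal_intensity_def point_measure_def interval_mass_def[abs_def] log_ratio_def ..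
  moreover have "(\<lambda>K. K) \<in> density (count_space (- {{}})) (interval_mass c) \<rightarrow>\<^sub>M nonempty_space"
    by (simp add: space_nonempty_space)
  ultimately have "emeasure (renewal_intensity c) A = emeasure (density (count_space (- {{}})) (interval_mass c)) A"
    using A sub by (simp add: emeasure_distr Int_absorb2)
  also have "\<dots> = (\<integral>\<^sup>+K. interval_mass c K * indicator A K \<partial>count_space (- {{}}))"
    using sub by (intro emeasure_density) auto
  also have "\<dots> = (\<integral>\<^sup>+K. interval_mass c K * indicator A K \<partial>count_space UNIV)"
    using sub by (intro nn_integral_count_space_eq) auto
  finally show ?thesis .
qed

text \<open>Only intervals carry mass, so any injective family that reaches the intervals in
  \<open>A\<close> may index the sum: codes for the Poisson process, pairs of lengths for the
  masses.\<close>

lemma emeasure_renewal_intensity_reindex: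
  fixes g :: "'i \<Rightarrow> int set"
  assumes A: "A \<in> sets nonempty_space" and g: "inj g" and sub: "A \<inter> finite_intervals \<subseteq> range g"
  shows "emeasure (renewal_intensity c) A = (\<integral>\<^sup>+i. interval_mass c (g i) * indicator A (g i) \<partial>count_space UNIV)"
proof -
  have "emeasure (renewal_intensity c) A = (\<integral>\<^sup>+K. interval_mass c K * indicator A K \<partial>count_space (range g))"
    unfolding emeasure_renewal_intensity[OF A]
    using sub by (intro nn_integral_count_space_eq) (auto simp: interval_mass_def indicator_def)
  also have "\<dots> = (\<integral>\<^sup>+i. interval_mass c (g i) * indicator A (g i) \<partial>count_space UNIV)"
    using g by (intro nn_integral_bij_count_space[symmetric]) (simp add: inj_on_imp_bij_betw)
  finally show ?thesis .
qed

lemma emeasure_renewal_intensity_cong: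
  assumes "A \<in> sets nonempty_space" "B \<in> sets nonempty_space" "A \<inter> finite_intervals = B \<inter> finite_intervals"
  shows "emeasure (renewal_intensity c) A = emeasure (renewal_intensity c) B"
  unfolding emeasure_renewal_intensity[OF assms(1)] emeasure_renewal_intensity[OF assms(2)]
  using assms(3) by (intro nn_integral_cong) (auto simp: interval_mass_def indicator_def)

lemma atLeastAtMost_finite_intervals: "a \<le> b \<Longrightarrow> {a..b::int} \<in> finite_intervals"
  by (auto simp: finite_intervals_def)

text \<open>A code consists of the left end and the length minus one, so that every natural number
  denotes a nonempty interval.\<close>

definition nth_interval :: "nat \<Rightarrow> int set" where
  "nth_interval m = (case prod_decode m of (a, d) \<Rightarrow> {int_decode a..int_decode a + int d})"

lemma inj_nth_interval: "inj nth_interval"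
proof (rule injI)
  fix m n assume eq: "nth_interval m = nth_interval n"
  obtain a d a' d' where dec: "prod_decode m = (a, d)" "prod_decode n = (a', d')"
    by (metis surj_pair)
  have "{int_decode a..int_decode a + int d} = {int_decode a'..int_decode a' + int d'}"
    using eq dec by (simp add: nth_interval_def)
  then have "int_decode a = int_decode a'" "d = d'" by (auto simp: Icc_eq_Icc)
  then have "prod_decode m = prod_decode n"
    using dec inj_int_decode by (auto dest: injD)
  then show "m = n" by simp
qed

lemma range_nth_interval: "finite_intervals \<subseteq> range nth_interval"
proof
  fix K assume "K \<in> finite_intervals"
  then obtain a b where K: "K = {a..b}" "a \<le> b" by (auto simp: finite_intervals_def)
  then have "K = nth_interval (prod_encode (int_encode a, nat (b - a)))"
    by (simp add: nth_interval_def)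
  then show "K \<in> range nth_interval" by blast
qed

lemma nth_interval_finite_intervals: "nth_interval m \<in> finite_intervals"
  by (auto simp: nth_interval_def split: prod.split intro: atLeastAtMost_finite_intervals)

text \<open>Translation permutes the subsets of the integers and preserves intervals and
  cardinalities, hence the masses. The rest is measurability, checked coordinatewise on
  indicators.\<close>

lemma translation_invariant_renewal_intensity: "translation_invariant (renewal_intensity c)"
  unfolding translation_invariant_def
proof
  fix k :: int
  let ?\<nu> = "renewal_intensity c" and ?f = "\<lambda>B. (+) k ` B"
  have mem: "i \<in> ?f B \<longleftrightarrow> i - k \<in> B" for i B
    by (auto simp: image_iff algebra_simps intro: bexI[of _ "i - k"])
  have "?f \<in> powerset_space \<rightarrow>\<^sub>M powerset_space"
    unfolding powerset_space_def
  proof (rule measurable_vimage_algebra2)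
    have "(\<lambda>B i. indicator (?f B) i :: nat) = (\<lambda>B i. indicator B (i - k))"
      by (auto simp: fun_eq_iff indicator_def mem)
    moreover have "(\<lambda>B i. indicator B (i - k) :: nat) \<in> powerset_space \<rightarrow>\<^sub>M bit_space"
    proof (rule measurable_bit_spaceI)
      fix i :: int
      have "(\<lambda>B i. indicator B i :: nat) \<in> powerset_space \<rightarrow>\<^sub>M (bit_space :: (int \<Rightarrow> nat) measure)"
        unfolding powerset_space_def
        by (rule measurable_vimage_algebra1) (auto simp: space_bit_space indicator_def)
      from measurable_compose[OF this measurable_bit_space_component[of "i - k"]]
      show "(\<lambda>B. indicator B (i - k) :: nat) \<in> powerset_space \<rightarrow>\<^sub>M count_space {0, 1}" .
    qed
    ultimately show "(\<lambda>B. indicator (?f B)) \<in> vimage_algebra UNIV indicator bit_space \<rightarrow>\<^sub>M bit_space"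
      by (simp add: powerset_space_def)
  qed simp
  then have "?f \<in> nonempty_space \<rightarrow>\<^sub>M nonempty_space"
    unfolding nonempty_space_def by (rule measurable_restrict_space3) auto
  then have f: "?f \<in> ?\<nu> \<rightarrow>\<^sub>M ?\<nu>"
    by (simp cong: measurable_cong_sets add: sets_renewal_intensity)
  have mass: "interval_mass c (?f K) = interval_mass c K" for K
  proof -
    have "?f K \<in> finite_intervals \<longleftrightarrow> K \<in> finite_intervals"
    proof
      assume "?f K \<in> finite_intervals"
      then obtain a b where ab: "a \<le> b" "?f K = {a..b}" by (auto simp: finite_intervals_def)
      have "x \<in> K \<longleftrightarrow> x \<in> {a - k..b - k}" for x
        using mem[of "x + k" K] ab(2) by auto
      then have "K = {a - k..b - k}" by blast
      with ab show "K \<in> finite_intervals" by (auto intro: atLeastAtMost_finite_intervals)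
    qed (auto simp: finite_intervals_def)
    moreover have "card (?f K) = card K" by (rule card_image) simp
    ultimately show ?thesis by (simp add: interval_mass_def)
  qed
  show "distr ?\<nu> ?\<nu> ?f = ?\<nu>"
  proof (rule measure_eqI)
    fix A assume "A \<in> sets (distr ?\<nu> ?\<nu> ?f)"
    then have A: "A \<in> sets nonempty_space" by (simp add: sets_renewal_intensity)
    have pre: "?f -` A \<inter> space ?\<nu> \<in> sets nonempty_space"
      using measurable_sets[OF f] A by (simp add: sets_renewal_intensity)
    have space: "space ?\<nu> = - {{}}" by (simp add: renewal_intensity_def space_nonempty_space)
    have "A \<subseteq> - {{}}" using sets.sets_into_space[OF A] by (simp add: space_nonempty_space)
    then have ind: "indicator (?f -` A \<inter> space ?\<nu>) K = (indicator A (?f K) :: ennreal)" for K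
      by (auto simp: indicator_def space)
    have "emeasure (distr ?\<nu> ?\<nu> ?f) A = emeasure ?\<nu> (?f -` A \<inter> space ?\<nu>)"
      using A by (intro emeasure_distr f) (simp add: sets_renewal_intensity)
    also have "\<dots> = (\<integral>\<^sup>+K. interval_mass c (?f K) * indicator A (?f K) \<partial>count_space UNIV)"
      by (simp add: emeasure_renewal_intensity[OF pre] ind mass)
    also have "\<dots> = (\<integral>\<^sup>+K. interval_mass c K * indicator A K \<partial>count_space UNIV)"
    proof (rule nn_integral_bij_count_space)
      show "bij_betw ?f UNIV UNIV"
        by (rule bij_betwI[of _ _ _ "\<lambda>B. (+) (- k) ` B"]) (auto simp: image_image)
    qed
    finally show "emeasure (distr ?\<nu> ?\<nu> ?f) A = emeasure ?\<nu> A"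
      by (simp add: emeasure_renewal_intensity[OF A])
  qed simp
qed

lemma poisson_process_renewal_intensity:
  assumes "\<And>n. 0 \<le> log_ratio c (Suc n)"
  shows "\<exists>(\<Omega> :: (nat set \<times> (nat \<Rightarrow> int set)) measure) I B. poisson_process \<Omega> (renewal_intensity c) I B"
proof -
  let ?r = "\<lambda>m. log_ratio c (card (nth_interval m))"
  have r: "0 \<le> ?r m" for m
  proof -
    have "finite (nth_interval m)" "nth_interval m \<noteq> {}"
      using nth_interval_finite_intervals[of m] by (auto simp: finite_intervals_def)
    then have "card (nth_interval m) = Suc (card (nth_interval m) - 1)"
      by (simp add: Suc_pred card_gt_0_iff)
    then show ?thesis using assms by metis
  qed
  \<comment> \<open>Any injection into the prescribed sample type will do; here a sequence is stored
    as a sequence of singletons.\<close>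
  define e :: "(nat \<Rightarrow> nat) \<Rightarrow> nat set \<times> (nat \<Rightarrow> int set)" where "e f = ({}, \<lambda>m. {int (f m)})" for f
  have "inj e" by (rule injI) (auto simp: e_def fun_eq_iff)
  with r obtain \<Omega> :: "(nat set \<times> (nat \<Rightarrow> int set)) measure" and N where "poisson_family \<Omega> N ?r"
    using poisson_family_exists[of ?r e] by blast
  then interpret poisson_family \<Omega> N ?r .
  have "poisson_process \<Omega> (renewal_intensity c)
      (\<lambda>\<omega>. {j. snd (prod_decode j) < N (fst (prod_decode j)) \<omega>}) (\<lambda>j \<omega>. nth_interval (fst (prod_decode j)))"
  proof (rule poisson_process_atomic)
    show "nth_interval m \<in> space (renewal_intensity c)" for m
      using nth_interval_finite_intervals[of m]
      by (auto simp: renewal_intensity_def space_nonempty_space finite_intervals_def)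
    fix A assume "A \<in> sets (renewal_intensity c)"
    then have A: "A \<in> sets nonempty_space" by (simp add: sets_renewal_intensity)
    have "emeasure (renewal_intensity c) A =
        (\<Sum>m. interval_mass c (nth_interval m) * indicator A (nth_interval m))"
      using emeasure_renewal_intensity_reindex[OF A inj_nth_interval] range_nth_interval
      by (auto simp: nn_integral_count_space_nat)
    also have "\<dots> = (\<Sum>m. ennreal (if nth_interval m \<in> A then ?r m else 0))"
      by (intro suminf_cong) (simp add: interval_mass_def nth_interval_finite_intervals)
    finally show "emeasure (renewal_intensity c) A = (\<Sum>m. ennreal (if nth_interval m \<in> A then ?r m else 0))" .
  qed
  then show ?thesis by blast
qed

section \<open>Mass of the intervals through a point\<close>

context log_convex_renewal
begin

text \<open>An interval containing \<open>e\<close> is determined by how far it reaches to the left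
  (\<open>s\<close>) and to the right (\<open>n\<close>) of \<open>e\<close>.\<close>

lemma emeasure_intervals_containing:
  fixes e :: int
  assumes A: "A \<in> sets nonempty_space" and cont: "\<And>K. K \<in> A \<Longrightarrow> e \<in> K"
  shows "emeasure (renewal_intensity c) A =
    (\<Sum>s. \<Sum>n. ennreal (log_ratio c (s + n + 1)) * indicator A {e - int s..e + int n})"
proof -
  let ?g = "\<lambda>(s, n). {e - int s..e + int n}"
  have "inj ?g" by (auto simp: inj_on_def Icc_eq_Icc)
  moreover have "A \<inter> finite_intervals \<subseteq> range ?g"
  proof safe
    fix K assume K: "K \<in> A" "K \<in> finite_intervals"
    then obtain a b where ab: "K = {a..b}" by (auto simp: finite_intervals_def)
    with cont[OF K(1)] have "K = ?g (nat (e - a), nat (b - e))" by simp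
    then show "K \<in> range ?g" by blast
  qed
  moreover have mass: "interval_mass c {e - int s..e + int n} = ennreal (log_ratio c (s + n + 1))" for s n
  proof -
    have "card {e - int s..e + int n} = s + n + 1" by (simp add: nat_eq_iff)
    then show ?thesis
      by (simp only: interval_mass_def) (simp add: atLeastAtMost_finite_intervals)
  qed
  ultimately have "emeasure (renewal_intensity c) A =
      (\<integral>\<^sup>+i. interval_mass c (?g i) * indicator A (?g i) \<partial>count_space UNIV)"
    by (intro emeasure_renewal_intensity_reindex[OF A])
  also have "\<dots> = (\<integral>\<^sup>+s. \<integral>\<^sup>+n. interval_mass c (?g (s, n)) * indicator A (?g (s, n)) \<partial>count_space UNIV \<partial>count_space UNIV)"
    by (rule nn_integral_fst_count_space[symmetric])
  finally show ?thesis by (simp add: nn_integral_count_space_nat mass)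
qed

lemma log_ratio_suminf:
  "(\<Sum>n. ennreal (log_ratio c (s + n + 1))) = ennreal (ln (c s) - ln (c (Suc s)))"
  using log_ratio_sums[of s] log_ratio_nonneg
  by (subst suminf_ennreal2) (auto simp: sums_iff)

lemma ln_increment_nonneg: "0 \<le> ln (c s) - ln (c (Suc s))"
  using c_decreasing[of s] c_pos by simp

lemma emeasure_containing: "emeasure (renewal_intensity c) {B. e \<in> B} = ennreal (- ln (c 0))"
proof -
  have "emeasure (renewal_intensity c) {B. e \<in> B} = (\<Sum>s. \<Sum>n. ennreal (log_ratio c (s + n + 1)))"
    by (subst emeasure_intervals_containing[of _ e]) (auto simp: sets_nonempty_space_contain)
  also have "\<dots> = (\<Sum>s. ennreal (ln (c s) - ln (c (Suc s))))"
    by (simp only: log_ratio_suminf)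
  also have "\<dots> = ennreal (- ln (c 0))"
    using ln_increments_sums ln_increment_nonneg by (subst suminf_ennreal2) (auto simp: sums_iff)
  finally show ?thesis .
qed

lemma emeasure_containing_avoiding:
  fixes e k :: int
  assumes "k < e"
  shows "emeasure (renewal_intensity c) {B. e \<in> B \<and> k \<notin> B} = ennreal (ln (c 0) - ln (c (nat (e - k))))"
proof -
  let ?d = "nat (e - k)"
  have A: "{B. e \<in> B \<and> k \<notin> B} \<in> sets nonempty_space"
  proof -
    have "{B. e \<in> B \<and> k \<notin> B} = {B. e \<in> B} - {B. k \<in> B}" by auto
    then show ?thesis by (simp add: sets_nonempty_space_contain sets.Diff)
  qed
  have "emeasure (renewal_intensity c) {B. e \<in> B \<and> k \<notin> B} =
      (\<Sum>s. \<Sum>n. ennreal (log_ratio c (s + n + 1)) * indicator {B. e \<in> B \<and> k \<notin> B} {e - int s..e + int n})"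
    by (rule emeasure_intervals_containing[OF A]) auto
  \<comment> \<open>Whatever \<open>n\<close> is, an interval with left end \<open>e - s\<close>
    avoids \<open>k < e\<close> exactly when \<open>s < e - k\<close>.\<close>
  also have "\<dots> = (\<Sum>s. (\<Sum>n. ennreal (log_ratio c (s + n + 1))) * indicator {..<?d} s)"
    using assms by (auto simp: indicator_def intro!: suminf_cong)
  also have "\<dots> = (\<Sum>s. ennreal (ln (c s) - ln (c (Suc s))) * indicator {..<?d} s)"
    by (simp only: log_ratio_suminf)
  also have "\<dots> = (\<Sum>s<?d. ennreal (ln (c s) - ln (c (Suc s))))"
    by (subst suminf_finite[of "{..<?d}"]) auto
  also have "\<dots> = ennreal (\<Sum>s<?d. ln (c s) - ln (c (Suc s)))"
    by (rule sum_ennreal) (rule ln_increment_nonneg)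
  also have "(\<Sum>s<?d. ln (c s) - ln (c (Suc s))) = ln (c 0) - ln (c ?d)"
    by (rule sum_lessThan_telescope')
  finally show ?thesis .
qed

text \<open>The countably many sets \<open>{B. i \<in> B}\<close> cover all nonempty sets and have
  finite mass by \<open>emeasure_containing\<close>.\<close>

lemma intensity_measure_renewal_intensity: "intensity_measure (renewal_intensity c)"
  unfolding intensity_measure_def
proof
  show "sigma_finite_measure (renewal_intensity c)"
  proof
    let ?A = "range (\<lambda>i::int. {B. i \<in> B})"
    have "countable ?A" "?A \<subseteq> sets (renewal_intensity c)"
      by (auto simp: sets_renewal_intensity sets_nonempty_space_contain)
    moreover have "\<Union>?A = space (renewal_intensity c)"
      by (auto simp: renewal_intensity_def space_nonempty_space)
    ultimately show "\<exists>A. countable A \<and> A \<subseteq> sets (renewal_intensity c) \<and>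
        \<Union>A = space (renewal_intensity c) \<and> (\<forall>a\<in>A. emeasure (renewal_intensity c) a \<noteq> \<infinity>)"
      by (intro exI[of _ ?A]) (auto simp: emeasure_containing)
  qed
qed (rule sets_renewal_intensity)

end

section \<open>The characterisation\<close>

context renewal
begin

lemma log_convex_if_poisson_representable:
  assumes "poisson_representable M X" "k \<ge> 1"
  shows "(c k)\<^sup>2 \<le> c (k - 1) * c (k + 1)"
proof -
  from assms(1) obtain \<nu> and \<Omega> :: "(nat set \<times> (nat \<Rightarrow> int set)) measure" and I B where
    \<nu>: "sets \<nu> = sets nonempty_space" and P: "poisson_process \<Omega> \<nu> I B"
    and law: "law M X = law \<Omega> (union_process I B)" and bit: "bit_process M X"
    by (auto simp: poisson_representable_def represented_by_def intensity_measure_def)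
  have prob_Z: "prob (Z A) = (if emeasure \<nu> (hitting A) = \<infinity> then 0 else exp (- measure \<nu> (hitting A)))" for A
    unfolding poisson_process_zeros[OF P \<nu>, symmetric]
    using measure_law_zeros[OF bit] measure_law_zeros[OF poisson_process_union_process[OF P \<nu>]] law
    by metis
  have sets: "hitting A \<in> sets \<nu>" for A by (simp add: \<nu> sets_nonempty_space_hitting)
  \<comment> \<open>Infinite mass would make the probability of a zero at \<open>i\<close> equal to
    0, against \<open>prob_zero_pos\<close>.\<close>
  have fin_single: "emeasure \<nu> (hitting {i}) \<noteq> \<infinity>" for i
    using prob_Z[of "{i}"] prob_zero[of i] prob_zero_pos by (auto split: if_splits)
  have fin: "emeasure \<nu> (hitting A) \<noteq> \<infinity>" if "finite A" for A
  proof -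
    have "emeasure \<nu> (hitting A) = emeasure \<nu> (\<Union>i\<in>A. hitting {i})"
      by (rule arg_cong[where f = "emeasure \<nu>"]) (auto simp: hitting_def)
    also have "\<dots> \<le> (\<Sum>i\<in>A. emeasure \<nu> (hitting {i}))"
      using that by (intro emeasure_subadditive_finite) (auto simp: sets)
    also have "\<dots> < \<infinity>" using that fin_single by (auto simp: less_top)
    finally show ?thesis by simp
  qed
  then have exp_Z: "prob (Z A) = exp (- measure \<nu> (hitting A))" if "finite A" for A
    using that prob_Z by simp
  have fm: "hitting A \<in> fmeasurable \<nu>" if "finite A" for A
    using fin[OF that] sets by (intro fmeasurableI) (auto simp: less_top)
  \<comment> \<open>The inclusion-exclusion argument takes the form of submodularity: the slack is
    the mass of the sets that hit both \<open>?l\<close> and \<open>?r\<close> but miss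
    \<open>0\<close> and \<open>k + 1\<close>, that is, contain \<open>1\<close> and
    \<open>k\<close>.\<close>
  let ?l = "{0, int k + 1, 1}" and ?r = "{0, int k + 1, int k}"
  have submodular: "measure \<nu> (hitting (?l \<union> ?r)) + measure \<nu> (hitting {0, int k + 1}) \<le>
      measure \<nu> (hitting ?l) + measure \<nu> (hitting ?r)"
  proof -
    have "hitting (?l \<union> ?r) = hitting ?l \<union> hitting ?r" by (auto simp: hitting_def)
    moreover have "measure \<nu> (hitting {0, int k + 1}) \<le> measure \<nu> (hitting ?l \<inter> hitting ?r)"
    proof (rule measure_mono_fmeasurable)
      show "hitting ?l \<inter> hitting ?r \<in> fmeasurable \<nu>" by (intro fmeasurable.Int fm) auto
      show "hitting {0, int k + 1} \<in> sets \<nu>" by (rule sets)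
    qed (auto simp: hitting_def)
    moreover have "measure \<nu> (hitting ?l \<union> hitting ?r) =
        measure \<nu> (hitting ?l) + measure \<nu> (hitting ?r) - measure \<nu> (hitting ?l \<inter> hitting ?r)"
      by (rule measure_Un3) (simp_all add: fm)
    ultimately show ?thesis by simp
  qed
  have "prob (Z ?l) * prob (Z ?r) \<le> prob (Z (?l \<union> ?r)) * prob (Z {0, int k + 1})"
    using submodular by (simp add: exp_Z flip: exp_add)
  moreover have Z_01: "prob (Z {0, 1}) = c 1" by (simp add: c_def)
  moreover have "prob (Z ?l) = c 1 * c k / c 0"
  proof -
    have "?l = insert (int k + 1) {0, 1}" by auto
    then show ?thesis using prob_zeros_insert[of 1 "{0, 1}" "int k + 1"] assms(2)
      by (simp add: Z_01)
  qed
  moreover have "prob (Z ?r) = c k * c 1 / c 0"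
  proof -
    have "?r = insert (int k + 1) {0, int k}" by auto
    then show ?thesis using prob_zeros_insert[of "int k" "{0, int k}" "int k + 1"]
      by (simp add: c_def[of k])
  qed
  moreover have "prob (Z (?l \<union> ?r)) = c 1 * c (k - 1) / c 0 * c 1 / c 0"
  proof -
    have "?l \<union> ?r = insert (int k + 1) (insert (int k) {0, 1})" by auto
    moreover have "prob (Z (insert (int k) {0, 1})) = c 1 * c (k - 1) / c 0"
      using prob_zeros_insert[of 1 "{0, 1}" "int k"] assms(2) by (simp add: Z_01 nat_diff_distrib)
    ultimately show ?thesis
      using prob_zeros_insert[of "int k" "insert (int k) {0, 1}" "int k + 1"] assms(2) by simp
  qed
  moreover have "prob (Z {0, int k + 1}) = c (k + 1)" by (simp add: c_def add.commute)
  \<comment> \<open>The product formula leaves the common factor \<open>(c 1 / c 0)\<^sup>2\<close>,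
    which can be cancelled since \<open>c 1\<close> is the exponential of a real number.\<close>
  ultimately have "(c 1 / c 0)\<^sup>2 * (c k)\<^sup>2 \<le> (c 1 / c 0)\<^sup>2 * (c (k - 1) * c (k + 1))"
    by (simp add: power2_eq_square field_simps)
  moreover have "c 1 > 0" using exp_Z[of "{0, 1}"] by (simp add: c_def)
  ultimately show ?thesis using c_0_pos by (subst (asm) mult_le_cancel_left_pos) auto
qed

text \<open>A new maximum \<open>e\<close> adds the mass of the sets that hit \<open>e\<close> but
  miss \<open>A\<close>, matching the factor \<open>c ?d / c 0\<close> of the product formula.
  Positivity is carried along to make the logarithms meaningful.\<close>

lemma emeasure_hitting:
  assumes "log_convex_renewal c tail" "finite A"
  shows "prob (Z A) > 0 \<and> emeasure (renewal_intensity c) (hitting A) = ennreal (- ln (prob (Z A)))"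
  using assms(2)
proof (induction A rule: finite_linorder_max_induct)
  case empty
  have "Z {} = space M" by (simp add: zeros_def)
  then show ?case by (simp add: hitting_def prob_space)
next
  case (insert e A)
  interpret log_convex_renewal c tail by fact
  show ?case
  proof (cases "A = {}")
    case True
    moreover have "hitting {e} = {B. e \<in> B}" by (auto simp: hitting_def)
    moreover have "prob (Z {e}) = c 0" using prob_zero[of e] by (simp add: c_def)
    ultimately show ?thesis using emeasure_containing[of e] c_0_pos by simp
  next
    case False
    define k where "k = Max A"
    have k: "k \<in> A" "\<And>i. i \<in> A \<Longrightarrow> i \<le> k" "k < e"
      using insert False by (auto simp: k_def)
    let ?D = "hitting (insert e A) - hitting A" and ?d = "nat (e - k)"
    have D: "?D \<in> sets nonempty_space" by (intro sets.Diff sets_nonempty_space_hitting)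
    have avoid: "{B. e \<in> B \<and> k \<notin> B} \<in> sets nonempty_space"
    proof -
      have "{B. e \<in> B \<and> k \<notin> B} = {B. e \<in> B} - {B. k \<in> B}" by auto
      then show ?thesis by (simp add: sets_nonempty_space_contain sets.Diff)
    qed
    have "?D \<inter> finite_intervals = {B. e \<in> B \<and> k \<notin> B} \<inter> finite_intervals"
      using k by (fastforce simp: hitting_def finite_intervals_def)
    then have "emeasure (renewal_intensity c) ?D = ennreal (ln (c 0) - ln (c ?d))"
      using emeasure_renewal_intensity_cong[OF D avoid] emeasure_containing_avoiding[OF k(3)] by simp
    moreover have "emeasure (renewal_intensity c) (hitting A) + emeasure (renewal_intensity c) ?D =
        emeasure (renewal_intensity c) (hitting A \<union> ?D)"
      by (rule plus_emeasure) (use D in \<open>auto simp: sets_renewal_intensity sets_nonempty_space_hitting\<close>)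
    moreover have "hitting A \<union> ?D = hitting (insert e A)" by (auto simp: hitting_def)
    \<comment> \<open>Monotonicity of \<open>c\<close> makes the increment nonnegative, so that
      \<open>ennreal\<close> does not truncate it and addition is preserved.\<close>
    moreover have "c ?d \<le> c 0" using decseqD[OF decseq_c, of 0 ?d] by simp
    then have "ln (c ?d) \<le> ln (c 0)" using c_pos by simp
    then have "ennreal (- ln (prob (Z A))) + ennreal (ln (c 0) - ln (c ?d)) =
        ennreal (- ln (prob (Z A)) + (ln (c 0) - ln (c ?d)))"
      using insert.IH by (intro ennreal_plus[symmetric]) auto
    ultimately have "emeasure (renewal_intensity c) (hitting (insert e A)) =
        ennreal (- ln (prob (Z A)) + (ln (c 0) - ln (c ?d)))"
      using insert.IH by simp
    moreover have P: "prob (Z (insert e A)) = prob (Z A) * c ?d / c 0"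
      using k by (intro prob_zeros_insert) auto
    then have "prob (Z (insert e A)) > 0" using insert.IH c_pos by simp
    moreover have "- ln (prob (Z (insert e A))) = - ln (prob (Z A)) + (ln (c 0) - ln (c ?d))"
      using insert.IH c_pos[of ?d] c_pos[of 0] by (simp add: P ln_div ln_mult)
    ultimately show ?thesis by simp
  qed
qed

lemma log_convex_renewalI:
  assumes "\<And>k. k \<ge> 1 \<Longrightarrow> (c k)\<^sup>2 \<le> c (k - 1) * c (k + 1)"
  shows "log_convex_renewal c tail"
  using assms c_nonneg c_le_1 c_0_pos exists_c_pos tail_nonneg tail_sums renewal_equation
  by unfold_locales auto

lemma represented_by_renewal_intensity:
  assumes "log_convex_renewal c tail"
  shows "represented_by M X (renewal_intensity c)"
proof -
  interpret L: log_convex_renewal c tail by fact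
  obtain \<Omega> :: "(nat set \<times> (nat \<Rightarrow> int set)) measure" and I B where
    P: "poisson_process \<Omega> (renewal_intensity c) I B"
    using poisson_process_renewal_intensity L.log_ratio_nonneg by blast
  have "law M X = law \<Omega> (union_process I B)"
  proof (rule law_eqI)
    show "bit_process M X" 
      unfolding bit_process_def using measurable_X prob_space_axioms by blast
    show "bit_process \<Omega> (union_process I B)"
      by (rule poisson_process_union_process[OF P sets_renewal_intensity])
    fix A :: "int set" assume "finite A"
    then have h: "prob (Z A) > 0" "emeasure (renewal_intensity c) (hitting A) = ennreal (- ln (prob (Z A)))"
      using emeasure_hitting[OF assms] by auto
    \<comment> \<open>As a probability is at most 1, \<open>- ln (prob (Z A))\<close> is
      nonnegative; exponentiating its negative then returns \<open>prob (Z A)\<close>.\<close>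
    then have "measure (renewal_intensity c) (hitting A) = - ln (prob (Z A))"
      by (intro measure_eq_emeasure_eq_ennreal) auto
    with h show "prob (Z A) = measure \<Omega> (zeros \<Omega> (union_process I B) A)"
      by (simp add: poisson_process_zeros[OF P sets_renewal_intensity])
  qed
  with P L.intensity_measure_renewal_intensity show ?thesis
    unfolding represented_by_def by blast
qed

end

theorem theorem3p5:
  fixes M :: "'w measure" and X :: "int \<Rightarrow> 'w \<Rightarrow> nat" and c :: "nat \<Rightarrow> real"
  assumes "renewal_process M X"
    and "measure M {\<omega> \<in> space M. X 0 \<omega> = 0} > 0"
    and "\<And>k. c k = zero_corr M X k"
  shows "(poisson_representable M X \<longleftrightarrow> (\<forall>k\<ge>1. c (k - 1) * c (k + 1) \<ge> (c k)\<^sup>2)) \<and>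
    ((\<forall>k\<ge>1. c (k - 1) * c (k + 1) \<ge> (c k)\<^sup>2) \<longrightarrow>
       translation_invariant (renewal_intensity c) \<and> represented_by M X (renewal_intensity c))"
proof -
  obtain b where "renewal M X b" using renewal_process_imp_renewal[OF assms(1,2)] by blast
  then interpret R: renewal M X b .
  have c: "R.c = c"
    by (rule ext) (simp add: R.c_def assms(3) zero_corr_def zeros_def)
  have "bit_process M X" using assms(1) by (simp add: renewal_process_def)
  then have "poisson_representable M X" if "represented_by M X (renewal_intensity c)"
    using that by (auto simp: poisson_representable_def)
  then show ?thesis
    using R.log_convex_if_poisson_representable R.log_convex_renewalI
      R.represented_by_renewal_intensity translation_invariant_renewal_intensity
    unfolding c by blast
qed

end
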